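(* Let $\mathcal A$ be a DG-category and $F:\mathcal A\to\mathcal A$ an invertible DG-functor. Then $F$ defines a strict $\mathbb Z$-action on $\mathcal A$ (where $\mathcal A$ is regarded as an $A_\infty$-category). There is an isomorphism of $A_\infty$-categories (which is also an isomorphism of DG-categories) $$\mathcal A *_F \mathbb Z \;\overset{\sim}{\longrightarrow}\; \mathcal A/F .$$
   Context: $k$ is a field and all categories are $k$-linear. $A_\infty$-categories follow Seidel's conventions: graded Hom spaces, structure maps $\mu^d$ of degree $2-d$ ($d\ge 1$), $|a|$ the degree of a homogeneous morphism $a$ and $\|a\|=|a|-1$, with relations $\sum_{m,n}(-1)^{\|a_1\|+\dots+\|a_n\|}\mu^{d-m+1}(a_d,\dots,a_{n+m+1},\mu^m(a_{n+m},\dots,a_{n+1}),a_n,\dots,a_1)=0$. All $A_\infty$-categories are strictly unital and all $A_\infty$-functors are strict (they commute strictly with all $\mu^d$) and unital. An isomorphism of $A_\infty$-categories is a strict $A_\infty$-functor that is bijective on objects and on morphism spaces. DG-categories as $A_\infty$-categories: a DG-category with differential $\partial$ and composition $\circ$ is the same as an $A_\infty$-category with $\mu^d=0$ for $d\ge 3$, via $\partial(f)=(-1)^{|f|}\mu^1(f)$ and $f\circ g=(-1)^{|g|}\mu^2(f,g)$. Strict action: a strict action of a group $G$ on an $A_\infty$-category $\mathcal A$ is a group homomorphism $\rho$ from $G$ to the group of invertible $A_\infty$-endofunctors of $\mathcal A$; one writes $g$ for $\rho(g)$. For $G=\mathbb Z$ (written multiplicatively with generator $\sigma$) and $F$ an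 invertible functor, the action is $\sigma^\ell\mapsto F^\ell$. Skew group $A_\infty$-category: $\mathcal A*_\rho G$ has the same objects as $\mathcal A$ (written $\{X\}$), $\mathrm{Hom}_{\mathcal A*_\rho G}(\{X\},\{Y\})=\bigoplus_{g\in G}\mathrm{Hom}_{\mathcal A}(gX,Y)$, where $a:gX\to Y$ gives the morphism $a\otimes g$, and $$\mu^n(a_n\otimes g_n,\dots,a_1\otimes g_1)=\mu^n_{\mathcal A}(a_n,\,g_na_{n-1},\dots,\,g_n\cdots g_2a_1)\otimes g_n\cdots g_1 .$$ $\mathcal A*_F\mathbb Z$ is the skew group category for the $\mathbb Z$-action defined by $F$. DG orbit category: $\mathcal A/F$ has the same objects as $\mathcal A$ and $\mathrm{Hom}_{\mathcal A/F}(X,Y)=\bigoplus_{\ell\in\mathbb Z}\mathrm{Hom}_{\mathcal A}(X,F^\ell Y)$, with differential induced by that of $\mathcal A$, and composition of $f:X\to F^\ell Y$ with $g:Y\to F^mZ$ given by $F^\ell(g)\circ f:X\to F^{\ell+m}Z$. *)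

theory Defs
  imports Complex_Main "HOL-Algebra.Elementary_Groups" "HOL-Library.Poly_Mapping"
begin

section \<open>Graded linear categories: underlying data\<close>

text \<open>
  A graded vector space is an int-indexed family of vector spaces, so \<open>Hom C X Y i\<close> is the space of
  morphisms of degree \<open>i\<close>. All these spaces are realised as subspaces of one ambient \<open>'k\<close>-vector space
  \<open>'m\<close> with scalar multiplication \<open>scl C\<close>; this is no restriction, since any family of vector spaces
  embeds in its direct sum. The spaces need not be disjoint or independent: source, target and
  degree of a homogeneous morphism are always carried along explicitly, as in the type \<open>arr\<close>.
  All multilinear structure is given on homogeneous morphisms.
\<close>

datatype ('o, 'm) arr = Arr (src: 'o) (tgt: 'o) (deg: int) (val: 'm)

record ('o, 'k, 'm) gcat =
  Ob :: "'o set"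
  Hom :: "'o \<Rightarrow> 'o \<Rightarrow> int \<Rightarrow> 'm set"
  scl :: "'k \<Rightarrow> 'm \<Rightarrow> 'm"
  ident :: "'o \<Rightarrow> 'm"

definition graded_cat :: "('o, 'k::field, 'm::ab_group_add, 'x) gcat_scheme \<Rightarrow> bool" where
  "graded_cat C \<longleftrightarrow>
     vector_space (scl C) \<and>
     (\<forall>X\<in>Ob C. \<forall>Y\<in>Ob C. \<forall>i. Modules.module.subspace (scl C) (Hom C X Y i)) \<and>
     (\<forall>X\<in>Ob C. ident C X \<in> Hom C X X 0)"

definition arrows :: "('o, 'k, 'm, 'x) gcat_scheme \<Rightarrow> ('o, 'm) arr set" where
  "arrows C = {a. src a \<in> Ob C \<and> tgt a \<in> Ob C \<and> val a \<in> Hom C (src a) (tgt a) (deg a)}"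

definition ident_arr :: "('o, 'k, 'm, 'x) gcat_scheme \<Rightarrow> 'o \<Rightarrow> ('o, 'm) arr" where
  "ident_arr C X = Arr X X 0 (ident C X)"

text \<open>Lists of composable morphisms are written in the order \<open>[a\<^sub>d, \<dots>, a\<^sub>1]\<close> with
  \<open>a\<^sub>j : X\<^sub>j\<^sub>-\<^sub>1 \<rightarrow> X\<^sub>j\<close>.\<close>

definition composable :: "('o, 'k, 'm, 'x) gcat_scheme \<Rightarrow> ('o, 'm) arr list \<Rightarrow> bool" where
  "composable C as \<longleftrightarrow>
     as \<noteq> [] \<and> set as \<subseteq> arrows C \<and> successively (\<lambda>b a. src b = tgt a) as"

definition sgn_pow :: "int \<Rightarrow> 'm::ab_group_add \<Rightarrow> 'm" where
  "sgn_pow i x = (if even i then x else - x)"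

section \<open>$A_\infty$-categories\<close>

record ('o, 'k, 'm) ainf = "('o, 'k, 'm) gcat" +
  mu :: "('o, 'm) arr list \<Rightarrow> 'm"

definition mu_arr :: "('o, 'k, 'm, 'x) ainf_scheme \<Rightarrow> ('o, 'm) arr list \<Rightarrow> ('o, 'm) arr" where
  "mu_arr A as =
     Arr (src (last as)) (tgt (hd as)) (sum_list (map deg as) + 2 - int (length as)) (mu A as)"

definition mu_multilinear :: "('o, 'k::field, 'm::ab_group_add, 'x) ainf_scheme \<Rightarrow> bool" where
  "mu_multilinear A \<longleftrightarrow>
     (\<forall>as bs X Y i x y c.
        composable A (as @ [Arr X Y i x] @ bs) \<and> composable A (as @ [Arr X Y i y] @ bs) \<longrightarrow>
          mu A (as @ [Arr X Y i (x + y)] @ bs)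
            = mu A (as @ [Arr X Y i x] @ bs) + mu A (as @ [Arr X Y i y] @ bs) \<and>
          mu A (as @ [Arr X Y i (scl A c x)] @ bs) = scl A c (mu A (as @ [Arr X Y i x] @ bs)))"

text \<open>With \<open>d = length as\<close>, the summand for \<open>(m, n)\<close> is
  \<open>\<mu>(a\<^sub>d, \<dots>, a\<^sub>n\<^sub>+\<^sub>m\<^sub>+\<^sub>1, \<mu>(a\<^sub>n\<^sub>+\<^sub>m, \<dots>, a\<^sub>n\<^sub>+\<^sub>1), a\<^sub>n, \<dots>, a\<^sub>1)\<close> with its sign.\<close>

definition ainf_relations :: "('o, 'k, 'm::ab_group_add, 'x) ainf_scheme \<Rightarrow> bool" where
  "ainf_relations A \<longleftrightarrow>
     (\<forall>as. composable A as \<longrightarrow>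
        (\<Sum>(m, n) \<in> {(m, n). 1 \<le> m \<and> m + n \<le> length as}.
           let d = length as; p = d - m - n in
           sgn_pow (\<Sum>a\<leftarrow>drop (d - n) as. deg a - 1)
             (mu A (take p as @ [mu_arr A (take m (drop p as))] @ drop (d - n) as))) = 0)"

definition strictly_unital :: "('o, 'k, 'm::ab_group_add, 'x) ainf_scheme \<Rightarrow> bool" where
  "strictly_unital A \<longleftrightarrow>
     (\<forall>X\<in>Ob A. mu A [ident_arr A X] = 0) \<and>
     (\<forall>a\<in>arrows A. sgn_pow (deg a) (mu A [ident_arr A (tgt a), a]) = val a \<and>
                    mu A [a, ident_arr A (src a)] = val a) \<and>
     (\<forall>as. composable A as \<and> 3 \<le> length as \<and> (\<exists>X\<in>Ob A. ident_arr A X \<in> set as) \<longrightarrow>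
        mu A as = 0)"

definition ainf_category :: "('o, 'k::field, 'm::ab_group_add, 'x) ainf_scheme \<Rightarrow> bool" where
  "ainf_category A \<longleftrightarrow>
     graded_cat A \<and>
     (\<forall>as. composable A as \<longrightarrow> mu_arr A as \<in> arrows A) \<and>
     mu_multilinear A \<and> ainf_relations A \<and> strictly_unital A"

section \<open>DG-categories\<close>

record ('o, 'k, 'm) dgcat = "('o, 'k, 'm) gcat" +
  bd :: "('o, 'm) arr \<Rightarrow> 'm"
  cmp :: "('o, 'm) arr \<Rightarrow> ('o, 'm) arr \<Rightarrow> 'm"

definition bd_arr :: "('o, 'k, 'm, 'x) dgcat_scheme \<Rightarrow> ('o, 'm) arr \<Rightarrow> ('o, 'm) arr" where
  "bd_arr D f = Arr (src f) (tgt f) (deg f + 1) (bd D f)"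

text \<open>\<open>cmp D f g\<close> is $f \circ g$, that is, first \<open>g\<close>, then \<open>f\<close>.\<close>

definition cmp_arr ::
  "('o, 'k, 'm, 'x) dgcat_scheme \<Rightarrow> ('o, 'm) arr \<Rightarrow> ('o, 'm) arr \<Rightarrow> ('o, 'm) arr" where
  "cmp_arr D f g = Arr (src g) (tgt f) (deg f + deg g) (cmp D f g)"

definition bd_linear :: "('o, 'k::field, 'm::ab_group_add, 'x) dgcat_scheme \<Rightarrow> bool" where
  "bd_linear D \<longleftrightarrow>
     (\<forall>X Y i x y c. Arr X Y i x \<in> arrows D \<and> Arr X Y i y \<in> arrows D \<longrightarrow>
        bd D (Arr X Y i (x + y)) = bd D (Arr X Y i x) + bd D (Arr X Y i y) \<and>
        bd D (Arr X Y i (scl D c x)) = scl D c (bd D (Arr X Y i x)))"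

definition cmp_bilinear :: "('o, 'k::field, 'm::ab_group_add, 'x) dgcat_scheme \<Rightarrow> bool" where
  "cmp_bilinear D \<longleftrightarrow>
     (\<forall>X Y i x y c f. Arr X Y i x \<in> arrows D \<and> Arr X Y i y \<in> arrows D \<and> f \<in> arrows D \<longrightarrow>
        (src f = Y \<longrightarrow>
           cmp D f (Arr X Y i (x + y)) = cmp D f (Arr X Y i x) + cmp D f (Arr X Y i y) \<and>
           cmp D f (Arr X Y i (scl D c x)) = scl D c (cmp D f (Arr X Y i x))) \<and>
        (tgt f = X \<longrightarrow>
           cmp D (Arr X Y i (x + y)) f = cmp D (Arr X Y i x) f + cmp D (Arr X Y i y) f \<and>
           cmp D (Arr X Y i (scl D c x)) f = scl D c (cmp D (Arr X Y i x) f)))"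

definition dg_category :: "('o, 'k::field, 'm::ab_group_add, 'x) dgcat_scheme \<Rightarrow> bool" where
  "dg_category D \<longleftrightarrow>
     graded_cat D \<and> bd_linear D \<and> cmp_bilinear D \<and>
     (\<forall>f\<in>arrows D. bd_arr D f \<in> arrows D \<and> bd D (bd_arr D f) = 0) \<and>
     (\<forall>f\<in>arrows D. cmp D (ident_arr D (tgt f)) f = val f \<and> cmp D f (ident_arr D (src f)) = val f) \<and>
     (\<forall>f\<in>arrows D. \<forall>g\<in>arrows D. src f = tgt g \<longrightarrow>
        cmp_arr D f g \<in> arrows D \<and>
        bd D (cmp_arr D f g) = cmp D (bd_arr D f) g + sgn_pow (deg f) (cmp D f (bd_arr D g))) \<and>
     (\<forall>f\<in>arrows D. \<forall>g\<in>arrows D. \<forall>h\<in>arrows D. src f = tgt g \<and> src g = tgt h \<longrightarrow>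
        cmp D (cmp_arr D f g) h = cmp D f (cmp_arr D g h))"

section \<open>DG-categories as $A_\infty$-categories\<close>

definition ainf_of_dg ::
  "('o, 'k, 'm::ab_group_add) dgcat \<Rightarrow> ('o, 'k, 'm) ainf" where
  "ainf_of_dg D =
     \<lparr>Ob = Ob D, Hom = Hom D, scl = scl D, ident = ident D,
      mu = (\<lambda>as. case as of
               [f] \<Rightarrow> sgn_pow (deg f) (bd D f)
             | [f, g] \<Rightarrow> sgn_pow (deg g) (cmp D f g)
             | _ \<Rightarrow> 0)\<rparr>"

definition higher_mu_vanish :: "('o, 'k, 'm::ab_group_add, 'x) ainf_scheme \<Rightarrow> bool" where
  "higher_mu_vanish A \<longleftrightarrow> (\<forall>as. composable A as \<and> 3 \<le> length as \<longrightarrow> mu A as = 0)"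

definition dg_of_ainf ::
  "('o, 'k, 'm::ab_group_add) ainf \<Rightarrow> ('o, 'k, 'm) dgcat" where
  "dg_of_ainf A =
     \<lparr>Ob = Ob A, Hom = Hom A, scl = scl A, ident = ident A,
      bd = (\<lambda>f. sgn_pow (deg f) (mu A [f])),
      cmp = (\<lambda>f g. sgn_pow (deg g) (mu A [f, g]))\<rparr>"

section \<open>Strict unital functors\<close>

record ('o, 'm, 'p, 'n) gfun =
  fob :: "'o \<Rightarrow> 'p"
  fmor :: "'o \<Rightarrow> 'o \<Rightarrow> int \<Rightarrow> 'm \<Rightarrow> 'n"

definition fmap :: "('o, 'm, 'p, 'n) gfun \<Rightarrow> ('o, 'm) arr \<Rightarrow> ('p, 'n) arr" where
  "fmap F a = Arr (fob F (src a)) (fob F (tgt a)) (deg a) (fmor F (src a) (tgt a) (deg a) (val a))"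

text \<open>Functors are normalised to be \<open>undefined\<close> off the category, so that equality of records is
  equality of functors (compare \<open>extensional\<close> and \<open>BijGroup\<close>).\<close>

definition frestrict ::
  "('o, 'k, 'm, 'x) gcat_scheme \<Rightarrow> ('o, 'm, 'p, 'n) gfun \<Rightarrow> ('o, 'm, 'p, 'n) gfun" where
  "frestrict C F =
     \<lparr>fob = restrict (fob F) (Ob C),
      fmor = (\<lambda>X Y i a. if Arr X Y i a \<in> arrows C then fmor F X Y i a else undefined)\<rparr>"

definition gfunctor ::
  "('o, 'k::field, 'm::ab_group_add, 'x) gcat_scheme \<Rightarrow>
   ('p, 'k, 'n::ab_group_add, 'y) gcat_scheme \<Rightarrow> ('o, 'm, 'p, 'n) gfun \<Rightarrow> bool" where
  "gfunctor C D F \<longleftrightarrow>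
     frestrict C F = F \<and>
     (\<forall>X\<in>Ob C. fob F X \<in> Ob D) \<and>
     (\<forall>a\<in>arrows C. fmap F a \<in> arrows D) \<and>
     (\<forall>X Y i x y c. Arr X Y i x \<in> arrows C \<and> Arr X Y i y \<in> arrows C \<longrightarrow>
        fmor F X Y i (x + y) = fmor F X Y i x + fmor F X Y i y \<and>
        fmor F X Y i (scl C c x) = scl D c (fmor F X Y i x)) \<and>
     (\<forall>X\<in>Ob C. fmap F (ident_arr C X) = ident_arr D (fob F X))"

definition ainf_functor ::
  "('o, 'k::field, 'm::ab_group_add) ainf \<Rightarrow> ('p, 'k, 'n::ab_group_add) ainf \<Rightarrow>
   ('o, 'm, 'p, 'n) gfun \<Rightarrow> bool" where
  "ainf_functor A B F \<longleftrightarrow>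
     gfunctor A B F \<and>
     (\<forall>as. composable A as \<longrightarrow> mu_arr B (map (fmap F) as) = fmap F (mu_arr A as))"

definition dg_functor ::
  "('o, 'k::field, 'm::ab_group_add) dgcat \<Rightarrow> ('p, 'k, 'n::ab_group_add) dgcat \<Rightarrow>
   ('o, 'm, 'p, 'n) gfun \<Rightarrow> bool" where
  "dg_functor C D F \<longleftrightarrow>
     gfunctor C D F \<and>
     (\<forall>f\<in>arrows C. bd_arr D (fmap F f) = fmap F (bd_arr C f)) \<and>
     (\<forall>f\<in>arrows C. \<forall>g\<in>arrows C. src f = tgt g \<longrightarrow>
        cmp_arr D (fmap F f) (fmap F g) = fmap F (cmp_arr C f g))"

definition bijective_functor ::
  "('o, 'k, 'm, 'x) gcat_scheme \<Rightarrow> ('p, 'k, 'n, 'y) gcat_scheme \<Rightarrow>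
   ('o, 'm, 'p, 'n) gfun \<Rightarrow> bool" where
  "bijective_functor C D F \<longleftrightarrow>
     bij_betw (fob F) (Ob C) (Ob D) \<and>
     (\<forall>X\<in>Ob C. \<forall>Y\<in>Ob C. \<forall>i.
        bij_betw (fmor F X Y i) (Hom C X Y i) (Hom D (fob F X) (fob F Y) i))"

definition ainf_iso ::
  "('o, 'k::field, 'm::ab_group_add) ainf \<Rightarrow> ('p, 'k, 'n::ab_group_add) ainf \<Rightarrow>
   ('o, 'm, 'p, 'n) gfun \<Rightarrow> bool" where
  "ainf_iso A B F \<longleftrightarrow>
     ainf_category A \<and> ainf_category B \<and> ainf_functor A B F \<and> bijective_functor A B F"

definition dg_iso ::
  "('o, 'k::field, 'm::ab_group_add) dgcat \<Rightarrow> ('p, 'k, 'n::ab_group_add) dgcat \<Rightarrow>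
   ('o, 'm, 'p, 'n) gfun \<Rightarrow> bool" where
  "dg_iso C D F \<longleftrightarrow>
     dg_category C \<and> dg_category D \<and> dg_functor C D F \<and> bijective_functor C D F"

section \<open>Groups of invertible endofunctors and strict actions\<close>

definition fun_id :: "('o, 'k, 'm, 'x) gcat_scheme \<Rightarrow> ('o, 'm, 'o, 'm) gfun" where
  "fun_id C = frestrict C \<lparr>fob = (\<lambda>X. X), fmor = (\<lambda>X Y i a. a)\<rparr>"

definition fun_comp ::
  "('o, 'k, 'm, 'x) gcat_scheme \<Rightarrow> ('o, 'm, 'o, 'm) gfun \<Rightarrow> ('o, 'm, 'o, 'm) gfun \<Rightarrow>
   ('o, 'm, 'o, 'm) gfun" where
  "fun_comp C G F = frestrict C
     \<lparr>fob = (\<lambda>X. fob G (fob F X)),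
      fmor = (\<lambda>X Y i a. fmor G (fob F X) (fob F Y) i (fmor F X Y i a))\<rparr>"

definition invertibles ::
  "('o, 'k, 'm, 'x) gcat_scheme \<Rightarrow> ('o, 'm, 'o, 'm) gfun set \<Rightarrow> ('o, 'm, 'o, 'm) gfun monoid" where
  "invertibles C E =
     \<lparr>carrier = {F \<in> E. \<exists>G\<in>E. fun_comp C G F = fun_id C \<and> fun_comp C F G = fun_id C},
      monoid.mult = fun_comp C, one = fun_id C\<rparr>"

definition ainf_Aut ::
  "('o, 'k::field, 'm::ab_group_add) ainf \<Rightarrow> ('o, 'm, 'o, 'm) gfun monoid" where
  "ainf_Aut A = invertibles A {F. ainf_functor A A F}"

definition dg_Aut ::
  "('o, 'k::field, 'm::ab_group_add) dgcat \<Rightarrow> ('o, 'm, 'o, 'm) gfun monoid" where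
  "dg_Aut D = invertibles D {F. dg_functor D D F}"

definition strict_action ::
  "'g monoid \<Rightarrow> ('o, 'k::field, 'm::ab_group_add) ainf \<Rightarrow> ('g \<Rightarrow> ('o, 'm, 'o, 'm) gfun) \<Rightarrow> bool" where
  "strict_action G A \<rho> \<longleftrightarrow> group G \<and> ainf_category A \<and> \<rho> \<in> hom G (ainf_Aut A)"

definition int_action ::
  "('o, 'k::field, 'm::ab_group_add) ainf \<Rightarrow> ('o, 'm, 'o, 'm) gfun \<Rightarrow> int \<Rightarrow> ('o, 'm, 'o, 'm) gfun" where
  "int_action A F = (\<lambda>l. F [^]\<^bsub>ainf_Aut A\<^esub> l)"

section \<open>Skew group $A_\infty$-categories\<close>

text \<open>A finitely supported function \<open>f\<close> stands for the sum of the $f(g) \otimes g$. The function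
  \<open>twist \<rho> [g\<^sub>n, \<dots>, g\<^sub>1] [f\<^sub>n, \<dots>, f\<^sub>1]\<close> is the list
  \<open>[a\<^sub>n, g\<^sub>na\<^sub>n\<^sub>-\<^sub>1, \<dots>, g\<^sub>n\<cdots>g\<^sub>2a\<^sub>1]\<close> where \<open>a\<^sub>j = f\<^sub>j(g\<^sub>j)\<close>, and the structure maps
  are the multilinear extensions of those on the \<open>a \<otimes> g\<close>.\<close>

fun twist ::
  "('g \<Rightarrow> ('o, 'm, 'o, 'm) gfun) \<Rightarrow> 'g list \<Rightarrow> ('o, 'g \<Rightarrow>\<^sub>0 'm::zero) arr list \<Rightarrow> ('o, 'm) arr list"
where
  "twist \<rho> (g # gs) (f # fs) =
     Arr (fob (\<rho> g) (src f)) (tgt f) (deg f) (Poly_Mapping.lookup (val f) g)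
       # map (fmap (\<rho> g)) (twist \<rho> gs fs)"
| "twist \<rho> _ _ = []"

definition skew ::
  "('o, 'k::field, 'm::ab_group_add) ainf \<Rightarrow> 'g monoid \<Rightarrow> ('g \<Rightarrow> ('o, 'm, 'o, 'm) gfun) \<Rightarrow>
   ('o, 'k, 'g \<Rightarrow>\<^sub>0 'm) ainf" where
  "skew A G \<rho> =
     \<lparr>Ob = Ob A,
      Hom = (\<lambda>X Y i. {f. Poly_Mapping.keys f \<subseteq> carrier G \<and>
                         (\<forall>g\<in>carrier G. Poly_Mapping.lookup f g \<in> Hom A (fob (\<rho> g) X) Y i)}),
      scl = (\<lambda>c. Poly_Mapping.map (scl A c)),
      ident = (\<lambda>X. Poly_Mapping.single \<one>\<^bsub>G\<^esub> (ident A X)),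
      mu = (\<lambda>fs. \<Sum>gs \<in> listset (map (\<lambda>f. Poly_Mapping.keys (val f)) fs).
              Poly_Mapping.single (foldr (\<otimes>\<^bsub>G\<^esub>) gs \<one>\<^bsub>G\<^esub>) (mu A (twist \<rho> gs fs)))\<rparr>"

section \<open>DG orbit categories\<close>

definition orbit_component ::
  "('o, 'k::field, 'm::ab_group_add) dgcat \<Rightarrow> ('o, 'm, 'o, 'm) gfun \<Rightarrow>
   ('o, int \<Rightarrow>\<^sub>0 'm) arr \<Rightarrow> int \<Rightarrow> ('o, 'm) arr" where
  "orbit_component D F f l =
     Arr (src f) (fob (F [^]\<^bsub>dg_Aut D\<^esub> l) (tgt f)) (deg f) (Poly_Mapping.lookup (val f) l)"

definition dg_orbit ::
  "('o, 'k::field, 'm::ab_group_add) dgcat \<Rightarrow> ('o, 'm, 'o, 'm) gfun \<Rightarrow>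
   ('o, 'k, int \<Rightarrow>\<^sub>0 'm) dgcat" where
  "dg_orbit D F =
     \<lparr>Ob = Ob D,
      Hom = (\<lambda>X Y i. {f. \<forall>l. Poly_Mapping.lookup f l \<in> Hom D X (fob (F [^]\<^bsub>dg_Aut D\<^esub> l) Y) i}),
      scl = (\<lambda>c. Poly_Mapping.map (scl D c)),
      ident = (\<lambda>X. Poly_Mapping.single 0 (ident D X)),
      bd = (\<lambda>f. \<Sum>l \<in> Poly_Mapping.keys (val f).
              Poly_Mapping.single l (bd D (orbit_component D F f l))),
      cmp = (\<lambda>g f. \<Sum>l \<in> Poly_Mapping.keys (val f). \<Sum>m \<in> Poly_Mapping.keys (val g).
              Poly_Mapping.single (l + m)
                (cmp D (fmap (F [^]\<^bsub>dg_Aut D\<^esub> l) (orbit_component D F g m))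
                       (orbit_component D F f l)))\<rparr>"

end

theory Submission
  imports Defs
begin

text \<open>Both the skew group category and the orbit category are direct totalisations of a \<open>\<int>\<close>-graded
  DG-category with the objects of \<open>A\<close>: in weight \<open>l\<close> the morphisms from \<open>X\<close> to \<open>Y\<close> are \<open>Hom(F\<^sup>l X, Y)\<close> in
  the first case and \<open>Hom(X, F\<^sup>l Y)\<close> in the second. Applying \<open>F\<^sup>-\<^sup>l\<close> in weight \<open>l\<close> identifies the former
  with the latter in weight \<open>-l\<close>. No signs enter, because the functors \<open>F\<^sup>l\<close> preserve degrees and the
  translation between DG- and $A_\infty$-structures inserts the same signs on both sides.\<close>

section \<open>DG-categories as $A_\infty$-categories\<close>

text \<open>The exponent -l is dictated by the two composition rules. In the skew category, b of
  weight v after a of weight w is b F^v(a). Applying F^-(v+w) turns this into F^-w(F^-v b) F^-w(a),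
  which is precisely the orbit composite of F^-v b (weight -v) with F^-w a (weight -w). The two
  categories add weights in opposite orders; for integers the orders agree, so one abstract notion
  of weighted DG-category covers both. An isomorphism is required to run between genuine categories,
  so most of the work is checking axioms; the abstract totalisation lets this be done once. The
  obstacle there is that a composite is a double sum over supports, and supports change under
  addition. Leibniz rule and associativity are therefore deduced by additivity from morphisms
  concentrated in one weight. Structure maps carry information only on genuine morphisms, so even
  d(0) = 0 has to be derived from additivity inside the right space. The skew category is shown to
  equal \<open>ainf_of_dg\<close> of a totalisation as a record, hence one and the same functor
  serves the DG and the A-infinity claim.\<close>

lemma sgn_pow_sgn_pow [simp]: "sgn_pow i (sgn_pow i x) = x"
  by (simp add: sgn_pow_def)

lemma sgn_pow_0 [simp]: "sgn_pow i 0 = 0"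
  by (simp add: sgn_pow_def)

lemma sgn_pow_add: "sgn_pow i (x + y) = sgn_pow i x + sgn_pow i y"
  by (simp add: sgn_pow_def)

lemma sgn_pow_sum: "sgn_pow i (sum f S) = (\<Sum>x\<in>S. sgn_pow i (f x))"
  by (simp add: sgn_pow_def sum_negf)

lemma Arr_in_arrows:
  "Arr X Y i x \<in> arrows C \<longleftrightarrow> X \<in> Ob C \<and> Y \<in> Ob C \<and> x \<in> Hom C X Y i"
  by (simp add: arrows_def)

lemma fmap_sel [simp]:
  "src (fmap F a) = fob F (src a)" "tgt (fmap F a) = fob F (tgt a)" "deg (fmap F a) = deg a"
  "val (fmap F a) = fmor F (src a) (tgt a) (deg a) (val a)"
  by (simp_all add: fmap_def)

lemma cmp_arr_sel [simp]:
  "src (cmp_arr D f g) = src g" "tgt (cmp_arr D f g) = tgt f" "deg (cmp_arr D f g) = deg f + deg g"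
  "val (cmp_arr D f g) = cmp D f g"
  by (simp_all add: cmp_arr_def)

lemma bd_arr_sel [simp]:
  "src (bd_arr D f) = src f" "tgt (bd_arr D f) = tgt f" "deg (bd_arr D f) = deg f + 1"
  "val (bd_arr D f) = bd D f"
  by (simp_all add: bd_arr_def)

lemma ident_arr_sel [simp]:
  "src (ident_arr C X) = X" "tgt (ident_arr C X) = X" "deg (ident_arr C X) = 0"
  "val (ident_arr C X) = ident C X"
  by (simp_all add: ident_arr_def)

lemma ainf_of_dg_sel [simp]:
  "Ob (ainf_of_dg D) = Ob D" "Hom (ainf_of_dg D) = Hom D" "scl (ainf_of_dg D) = scl D"
  "ident (ainf_of_dg D) = ident D"
  by (simp_all add: ainf_of_dg_def)

lemma arrows_ainf_of_dg [simp]: "arrows (ainf_of_dg D) = arrows D"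
  by (simp add: arrows_def)

lemma ident_arr_ainf_of_dg [simp]: "ident_arr (ainf_of_dg D) = ident_arr D"
  by (simp add: ident_arr_def fun_eq_iff)

lemma graded_cat_ainf_of_dg [simp]: "graded_cat (ainf_of_dg D) = graded_cat D"
  by (simp add: graded_cat_def)

lemma frestrict_ainf_of_dg [simp]: "frestrict (ainf_of_dg C) = frestrict C"
  by (simp add: frestrict_def fun_eq_iff)

lemma gfunctor_ainf_of_dg [simp]: "gfunctor (ainf_of_dg C) (ainf_of_dg D) = gfunctor C D"
  by (simp add: gfunctor_def fun_eq_iff)

lemma composable_ainf_of_dg [simp]: "composable (ainf_of_dg C) = composable C"
  by (simp add: composable_def fun_eq_iff)

lemma bijective_functor_ainf_of_dg [simp]:
  "bijective_functor (ainf_of_dg C) (ainf_of_dg D) = bijective_functor C D"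
  by (simp add: bijective_functor_def fun_eq_iff)

lemma mu_ainf_of_dg [simp]:
  "mu (ainf_of_dg D) [] = 0"
  "mu (ainf_of_dg D) [f] = sgn_pow (deg f) (bd D f)"
  "mu (ainf_of_dg D) [f, g] = sgn_pow (deg g) (cmp D f g)"
  "mu (ainf_of_dg D) (f # g # h # fs) = 0"
  by (simp_all add: ainf_of_dg_def)

text \<open>The catch-all branch of \<open>ainf_of_dg\<close> is 0 on every list, so long terms
  vanish without a typing check.\<close>

lemma mu_ainf_of_dg_higher:
  assumes "3 \<le> length as"
  shows "mu (ainf_of_dg D) as = 0"
  using assms by (auto simp: numeral_3_eq_3 Suc_le_length_iff)

lemma higher_mu_vanish_ainf_of_dg: "higher_mu_vanish (ainf_of_dg D)"
  by (simp add: higher_mu_vanish_def mu_ainf_of_dg_higher)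

text \<open>The sign inserted by one translation is removed by the other, since its square is
  1.\<close>

lemma dg_of_ainf_ainf_of_dg: "dg_of_ainf (ainf_of_dg D) = D"
  by (simp add: dg_of_ainf_def)

section \<open>Linearity and closure facts for graded categories, functors and DG-categories\<close>

lemma graded_cat_subspace:
  assumes "graded_cat C" "X \<in> Ob C" "Y \<in> Ob C"
  shows "0 \<in> Hom C X Y i"
    and "x \<in> Hom C X Y i \<Longrightarrow> y \<in> Hom C X Y i \<Longrightarrow> x + y \<in> Hom C X Y i"
    and "x \<in> Hom C X Y i \<Longrightarrow> scl C c x \<in> Hom C X Y i"
    and "x \<in> Hom C X Y i \<Longrightarrow> - x \<in> Hom C X Y i"
    and "x \<in> Hom C X Y i \<Longrightarrow> sgn_pow j x \<in> Hom C X Y i"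
proof -
  interpret vector_space "scl C" using assms(1) by (simp add: graded_cat_def)
  have sub: "subspace (Hom C X Y i)" using assms by (simp add: graded_cat_def)
  show "0 \<in> Hom C X Y i" by (rule subspace_0[OF sub])
  show "x \<in> Hom C X Y i \<Longrightarrow> y \<in> Hom C X Y i \<Longrightarrow> x + y \<in> Hom C X Y i"
    by (rule subspace_add[OF sub])
  show "x \<in> Hom C X Y i \<Longrightarrow> scl C c x \<in> Hom C X Y i" by (rule subspace_scale[OF sub])
  show neg: "x \<in> Hom C X Y i \<Longrightarrow> - x \<in> Hom C X Y i" by (rule subspace_neg[OF sub])
  show "x \<in> Hom C X Y i \<Longrightarrow> sgn_pow j x \<in> Hom C X Y i" using neg by (simp add: sgn_pow_def)
qed

lemma ident_arr_in_arrows: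
  assumes "graded_cat C" "X \<in> Ob C"
  shows "ident_arr C X \<in> arrows C"
  using assms by (simp add: ident_arr_def arrows_def graded_cat_def)

lemma gfunctor_map:
  assumes "gfunctor C D F" "a \<in> arrows C"
  shows "fmap F a \<in> arrows D"
  using assms by (simp add: gfunctor_def)

lemma gfunctor_ob:
  assumes "gfunctor C D F" "X \<in> Ob C"
  shows "fob F X \<in> Ob D"
  using assms by (simp add: gfunctor_def)

lemma gfunctor_hom:
  assumes "gfunctor C D F" "X \<in> Ob C" "Y \<in> Ob C" "x \<in> Hom C X Y i"
  shows "fmor F X Y i x \<in> Hom D (fob F X) (fob F Y) i"
  using gfunctor_map[OF assms(1), of "Arr X Y i x"] assms by (simp add: arrows_def)

lemma gfunctor_add:
  assumes "gfunctor C D F" "X \<in> Ob C" "Y \<in> Ob C" "x \<in> Hom C X Y i" "y \<in> Hom C X Y i"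
  shows "fmor F X Y i (x + y) = fmor F X Y i x + fmor F X Y i y"
  using assms by (simp add: gfunctor_def Arr_in_arrows)

lemma gfunctor_scale:
  assumes "gfunctor C D F" "X \<in> Ob C" "Y \<in> Ob C" "x \<in> Hom C X Y i"
  shows "fmor F X Y i (scl C c x) = scl D c (fmor F X Y i x)"
  using assms unfolding gfunctor_def Arr_in_arrows by blast

lemma gfunctor_zero:
  assumes "graded_cat C" "gfunctor C D F" "X \<in> Ob C" "Y \<in> Ob C"
  shows "fmor F X Y i 0 = 0"
  using gfunctor_add[OF assms(2-4), of 0 i 0] graded_cat_subspace(1)[OF assms(1,3,4)] by simp

lemma gfunctor_sgn_pow:
  assumes "graded_cat C" "gfunctor C D F" "X \<in> Ob C" "Y \<in> Ob C" "x \<in> Hom C X Y i"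
  shows "fmor F X Y i (sgn_pow j x) = sgn_pow j (fmor F X Y i x)"
proof -
  have "fmor F X Y i x + fmor F X Y i (- x) = 0"
    using gfunctor_add[OF assms(2-5), of "- x"] graded_cat_subspace(4)[OF assms(1,3-5)]
      gfunctor_zero[OF assms(1-4)] by simp
  then show ?thesis by (simp add: sgn_pow_def add_eq_0_iff)
qed

lemma dg_category_graded: "dg_category D \<Longrightarrow> graded_cat D"
  by (simp add: dg_category_def)

lemma bd_closed:
  assumes "dg_category D" "f \<in> arrows D"
  shows "bd_arr D f \<in> arrows D" "bd D (bd_arr D f) = 0"
  using assms by (simp_all add: dg_category_def)

lemma cmp_closed:
  assumes "dg_category D" "f \<in> arrows D" "g \<in> arrows D" "src f = tgt g"
  shows "cmp_arr D f g \<in> arrows D"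
  using assms by (simp add: dg_category_def)

lemma cmp_assoc:
  assumes "dg_category D" "f \<in> arrows D" "g \<in> arrows D" "h \<in> arrows D"
    "src f = tgt g" "src g = tgt h"
  shows "cmp D (cmp_arr D f g) h = cmp D f (cmp_arr D g h)"
  using assms by (simp add: dg_category_def)

lemma bd_cmp:
  assumes "dg_category D" "f \<in> arrows D" "g \<in> arrows D" "src f = tgt g"
  shows "bd D (cmp_arr D f g) = cmp D (bd_arr D f) g + sgn_pow (deg f) (cmp D f (bd_arr D g))"
  using assms by (simp add: dg_category_def)

lemma cmp_ident:
  assumes "dg_category D" "f \<in> arrows D"
  shows "cmp D (ident_arr D (tgt f)) f = val f" "cmp D f (ident_arr D (src f)) = val f"
  using assms by (simp_all add: dg_category_def)

lemma bd_add:
  assumes "dg_category D" "Arr X Y i x \<in> arrows D" "Arr X Y i y \<in> arrows D"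
  shows "bd D (Arr X Y i (x + y)) = bd D (Arr X Y i x) + bd D (Arr X Y i y)"
  using assms unfolding dg_category_def bd_linear_def by blast

lemma bd_scale:
  assumes "dg_category D" "Arr X Y i x \<in> arrows D"
  shows "bd D (Arr X Y i (scl D c x)) = scl D c (bd D (Arr X Y i x))"
  using assms unfolding dg_category_def bd_linear_def by blast

lemma cmp_add:
  assumes "dg_category D" "Arr X Y i x \<in> arrows D" "Arr X Y i y \<in> arrows D" "f \<in> arrows D"
  shows "src f = Y \<Longrightarrow> cmp D f (Arr X Y i (x + y)) = cmp D f (Arr X Y i x) + cmp D f (Arr X Y i y)"
    and "tgt f = X \<Longrightarrow> cmp D (Arr X Y i (x + y)) f = cmp D (Arr X Y i x) f + cmp D (Arr X Y i y) f"
  using assms unfolding dg_category_def cmp_bilinear_def by blast+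

lemma cmp_scale:
  assumes "dg_category D" "Arr X Y i x \<in> arrows D" "f \<in> arrows D"
  shows "src f = Y \<Longrightarrow> cmp D f (Arr X Y i (scl D c x)) = scl D c (cmp D f (Arr X Y i x))"
    and "tgt f = X \<Longrightarrow> cmp D (Arr X Y i (scl D c x)) f = scl D c (cmp D (Arr X Y i x) f)"
  using assms unfolding dg_category_def cmp_bilinear_def by blast+

lemma zero_in_arrows:
  assumes "dg_category D" "X \<in> Ob D" "Y \<in> Ob D"
  shows "Arr X Y i 0 \<in> arrows D"
  using graded_cat_subspace(1)[OF dg_category_graded[OF assms(1)] assms(2,3)] assms(2,3)
  by (simp add: Arr_in_arrows)

lemma sgn_pow_in_arrows:
  assumes "dg_category D" "Arr X Y i x \<in> arrows D"
  shows "Arr X Y i (sgn_pow j x) \<in> arrows D"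
  using graded_cat_subspace(5)[OF dg_category_graded[OF assms(1)]] assms(2)
  by (simp add: Arr_in_arrows)

lemma bd_zero:
  assumes "dg_category D" "X \<in> Ob D" "Y \<in> Ob D"
  shows "bd D (Arr X Y i 0) = 0"
  using bd_add[OF assms(1) zero_in_arrows[OF assms, of i] zero_in_arrows[OF assms, of i]] by simp

lemma cmp_zero:
  assumes "dg_category D" "X \<in> Ob D" "Y \<in> Ob D" "f \<in> arrows D"
  shows "src f = Y \<Longrightarrow> cmp D f (Arr X Y i 0) = 0" "tgt f = X \<Longrightarrow> cmp D (Arr X Y i 0) f = 0"
  using cmp_add[OF assms(1) zero_in_arrows[OF assms(1-3), of i] zero_in_arrows[OF assms(1-3), of i]
      assms(4)] by simp_all

lemma bd_sgn_pow:
  assumes "dg_category D" "Arr X Y i x \<in> arrows D"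
  shows "bd D (Arr X Y i (sgn_pow j x)) = sgn_pow j (bd D (Arr X Y i x))"
proof -
  have "Arr X Y i (- x) \<in> arrows D"
    using sgn_pow_in_arrows[OF assms, of 1] by (simp add: sgn_pow_def)
  from bd_add[OF assms this] bd_zero[OF assms(1)] assms(2) show ?thesis
    by (simp add: sgn_pow_def Arr_in_arrows add_eq_0_iff)
qed

lemma cmp_sgn_pow:
  assumes "dg_category D" "Arr X Y i x \<in> arrows D" "f \<in> arrows D"
  shows "src f = Y \<Longrightarrow> cmp D f (Arr X Y i (sgn_pow j x)) = sgn_pow j (cmp D f (Arr X Y i x))"
    and "tgt f = X \<Longrightarrow> cmp D (Arr X Y i (sgn_pow j x)) f = sgn_pow j (cmp D (Arr X Y i x) f)"
proof -
  have m: "Arr X Y i (- x) \<in> arrows D"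
    using sgn_pow_in_arrows[OF assms(1,2), of 1] by (simp add: sgn_pow_def)
  show "cmp D f (Arr X Y i (sgn_pow j x)) = sgn_pow j (cmp D f (Arr X Y i x))" if "src f = Y"
    using cmp_add(1)[OF assms(1,2) m assms(3) that] cmp_zero(1)[OF assms(1) _ _ assms(3) that] assms(2)
    by (simp add: sgn_pow_def Arr_in_arrows add_eq_0_iff)
  show "cmp D (Arr X Y i (sgn_pow j x)) f = sgn_pow j (cmp D (Arr X Y i x) f)" if "tgt f = X"
    using cmp_add(2)[OF assms(1,2) m assms(3) that] cmp_zero(2)[OF assms(1) _ _ assms(3) that] assms(2)
    by (simp add: sgn_pow_def Arr_in_arrows add_eq_0_iff)
qed

text \<open>A unit e has degree 0 and e e = e, so the Leibniz rule reads d e = d e + d e.\<close>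

lemma bd_ident:
  assumes D: "dg_category D" and X: "X \<in> Ob D"
  shows "bd D (ident_arr D X) = 0"
proof -
  let ?e = "ident_arr D X"
  have e: "?e \<in> arrows D" by (rule ident_arr_in_arrows[OF dg_category_graded[OF D] X])
  have "cmp_arr D ?e ?e = ?e"
    using cmp_ident(1)[OF D e] by (simp add: cmp_arr_def ident_arr_def)
  moreover have "cmp D (bd_arr D ?e) ?e = bd D ?e" "cmp D ?e (bd_arr D ?e) = bd D ?e"
    using cmp_ident[OF D bd_closed(1)[OF D e]] by simp_all
  ultimately show ?thesis using bd_cmp[OF D e e] by (simp add: sgn_pow_def)
qed

section \<open>The A-infinity axioms for a DG-category\<close>

lemma composable_Cons:
  "composable C [a] \<longleftrightarrow> a \<in> arrows C"
  "composable C (b # a # as) \<longleftrightarrow> b \<in> arrows C \<and> src b = tgt a \<and> composable C (a # as)"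
  by (auto simp: composable_def)

lemma composable_ends:
  assumes "composable C as"
  shows "src (last as) \<in> Ob C" "tgt (hd as) \<in> Ob C"
proof -
  have "last as \<in> arrows C" "hd as \<in> arrows C" using assms by (auto simp: composable_def)
  then show "src (last as) \<in> Ob C" "tgt (hd as) \<in> Ob C" by (simp_all add: arrows_def)
qed

text \<open>The split follows the clauses of \<open>ainf_of_dg\<close>: arities one and two carry
  structure, and from three on everything is zero.\<close>

lemma list_short_cases:
  obtains "as = []" | a where "as = [a]" | b a where "as = [b, a]" | "3 \<le> length as"
proof (cases as)
  case (Cons a bs)
  then show ?thesis using that by (cases bs rule: list.exhaust; cases "tl bs") auto
qed (use that in auto)

lemma mu_arr_ainf_of_dg:
  "mu_arr (ainf_of_dg D) [f]
     = Arr (src f) (tgt f) (deg f + 1) (sgn_pow (deg f) (bd D f))"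
  "mu_arr (ainf_of_dg D) [f, g]
     = Arr (src g) (tgt f) (deg f + deg g) (sgn_pow (deg g) (cmp D f g))"
  by (simp_all add: mu_arr_def)

lemma mu_arr_ainf_of_dg_in_arrows:
  assumes D: "dg_category D" and as: "composable D as"
  shows "mu_arr (ainf_of_dg D) as \<in> arrows D"
proof (cases as rule: list_short_cases)
  case 1 with as show ?thesis by (simp add: composable_def)
next
  case (2 a)
  with as bd_closed(1)[OF D, of a] show ?thesis
    by (simp add: mu_arr_ainf_of_dg composable_Cons bd_arr_def sgn_pow_in_arrows[OF D])
next
  case (3 b a)
  with as cmp_closed[OF D, of b a] show ?thesis
    by (simp add: mu_arr_ainf_of_dg composable_Cons cmp_arr_def sgn_pow_in_arrows[OF D])
next
  case 4
  then show ?thesis using composable_ends[OF as]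
    by (simp add: mu_arr_def mu_ainf_of_dg_higher zero_in_arrows[OF D])
qed

lemma mu_multilinear_ainf_of_dg:
  assumes D: "dg_category D"
  shows "mu_multilinear (ainf_of_dg D)"
  unfolding mu_multilinear_def
proof (intro allI impI)
  fix as bs X Y i x y c
  assume c: "composable (ainf_of_dg D) (as @ [Arr X Y i x] @ bs) \<and>
    composable (ainf_of_dg D) (as @ [Arr X Y i y] @ bs)"
  let ?m = "mu (ainf_of_dg D)"
  let ?P = "?m (as @ [Arr X Y i (x + y)] @ bs) = ?m (as @ [Arr X Y i x] @ bs) + ?m (as @ [Arr X Y i y] @ bs)
    \<and> ?m (as @ [Arr X Y i (scl (ainf_of_dg D) c x)] @ bs) = scl (ainf_of_dg D) c (?m (as @ [Arr X Y i x] @ bs))"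
  interpret vector_space "scl D" using D by (simp add: dg_category_def graded_cat_def)
  have scl_sgn: "scl D c (sgn_pow j z) = sgn_pow j (scl D c z)" for j z
    by (simp add: sgn_pow_def)
  \<comment> \<open>The varied argument sits in a list of length one, in one of the two places of a
    list of length two, or in a list of length at least three, where \<open>mu\<close>
    vanishes.\<close>
  consider "as = []" "bs = []" | b where "as = [b]" "bs = []" | b where "as = []" "bs = [b]"
    | "2 \<le> length as + length bs"
    by (cases as; cases bs; cases "tl as"; cases "tl bs") auto
  then show ?P
  proof cases
    case 1
    with c show ?thesis
      by (simp add: composable_Cons bd_add[OF D] bd_scale[OF D] scl_sgn sgn_pow_add)
  next
    case 2
    with c show ?thesis
      by (simp add: composable_Cons cmp_add[OF D] cmp_scale[OF D] scl_sgn sgn_pow_add)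
  next
    case 3
    with c show ?thesis
      by (auto simp: composable_Cons cmp_add[OF D] cmp_scale[OF D] scl_sgn sgn_pow_add)
  next
    case 4
    then have "?m (as @ [z] @ bs) = 0" for z by (intro mu_ainf_of_dg_higher) simp
    then show ?thesis by simp
  qed
qed

text \<open>With d >= 4 inputs and inner arity m, the outer arity is d - m + 1; both cannot be at
  most 2. If the outer map is long, it vanishes. Otherwise the inner value is 0 and the outer map is
  unary or binary, so \<open>bd_zero\<close> or \<open>cmp_zero\<close> finishes.\<close>

lemma mu_ainf_of_dg_inner:
  assumes D: "dg_category D" and c: "composable D (us @ vs @ ws)"
    and vs: "vs \<noteq> []" and len: "4 \<le> length us + length vs + length ws"
  shows "mu (ainf_of_dg D) (us @ [mu_arr (ainf_of_dg D) vs] @ ws) = 0"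
proof (cases "2 \<le> length us + length ws")
  case True
  then show ?thesis by (intro mu_ainf_of_dg_higher) simp
next
  case False
  then have mu0: "mu (ainf_of_dg D) vs = 0"
    using len by (intro mu_ainf_of_dg_higher) simp
  have cv: "composable D vs"
    using c vs by (auto simp: composable_def successively_append_iff)
  note en = composable_ends[OF cv]
  from False consider "us = []" "ws = []" | x where "us = [x]" "ws = []" | x where "us = []" "ws = [x]"
    by (cases us; cases ws; cases "tl us"; cases "tl ws") auto
  then show ?thesis
  proof cases
    case 1
    then show ?thesis using en by (simp add: mu_arr_def mu0 bd_zero[OF D])
  next
    case (2 x)
    then have "x \<in> arrows D" "src x = tgt (hd vs)"
      using c vs by (auto simp: composable_def successively_append_iff successively_Cons)
    then show ?thesis using 2 en by (simp add: mu_arr_def mu0 cmp_zero[OF D])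
  next
    case (3 x)
    then have "x \<in> arrows D" "tgt x = src (last vs)"
      using c vs by (auto simp: composable_def successively_append_iff)
    then show ?thesis using 3 en by (simp add: mu_arr_def mu0 cmp_zero[OF D])
  qed
qed

text \<open>For one, two and three inputs the relation is, up to a global sign, d d = 0, the Leibniz
  rule and associativity. From four inputs on, every summand vanishes separately.\<close>

lemma ainf_relations_ainf_of_dg:
  assumes D: "dg_category D"
  shows "ainf_relations (ainf_of_dg D)"
  unfolding ainf_relations_def
proof (intro allI impI)
  fix as assume "composable (ainf_of_dg D) as"
  then have c: "composable D as" by simp
  let ?A = "ainf_of_dg D"
  let ?t = "\<lambda>m n. let d = length as; p = d - m - n in
           sgn_pow (\<Sum>a\<leftarrow>drop (d - n) as. deg a - 1)
             (mu ?A (take p as @ [mu_arr ?A (take m (drop p as))] @ drop (d - n) as))"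
  let ?I = "{(m, n). 1 \<le> m \<and> m + n \<le> length as}"
  \<comment> \<open>The index sets are listed so that the sums become explicit; in (m, n), m is the
    inner arity and n the number of inputs to the right of the inner map.\<close>
  have I1: "{(m, n). 1 \<le> m \<and> m + n \<le> Suc 0} = {(1::nat, 0::nat)}" by auto
  have I2: "{(m, n). 1 \<le> m \<and> m + n \<le> Suc (Suc 0)} = {(1::nat, 0::nat), (1, 1), (2, 0)}"
    by (auto simp: le_Suc_eq)
  have I3: "{(m, n). 1 \<le> m \<and> m + n \<le> Suc (Suc (Suc 0))}
    = {(1::nat, 0::nat), (1, 1), (1, 2), (2, 0), (2, 1), (3, 0)}"
    by (auto simp: le_Suc_eq)
  show "(\<Sum>(m, n)\<in>?I. ?t m n) = 0"
  proof (cases as rule: list_short_cases)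
    case 1 with c show ?thesis by (simp add: composable_def)
  next
    case (2 a)
    with c have a: "a \<in> arrows D" by (simp add: composable_Cons)
    note ba = bd_closed[OF D a, unfolded bd_arr_def]
    show ?thesis using 2 by (simp add: I1[simplified] mu_arr_ainf_of_dg bd_sgn_pow[OF D ba(1)] ba(2))
  next
    case (3 b a)
    with c have a: "a \<in> arrows D" and b: "b \<in> arrows D" and ab: "src b = tgt a"
      by (simp_all add: composable_Cons)
    note ba = bd_closed[OF D a, unfolded bd_arr_def]
    note bb = bd_closed[OF D b, unfolded bd_arr_def]
    note cc = cmp_closed[OF D b a ab, unfolded cmp_arr_def]
    note L = bd_cmp[OF D b a ab, unfolded cmp_arr_def bd_arr_def]
    \<comment> \<open>Up to the common factor (-1)^|b| the three terms are d(ba), -(db)a and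
      -(-1)^|b| b(da).\<close>
    show ?thesis using 3 ab
      by (simp add: I2[simplified] mu_arr_ainf_of_dg bd_sgn_pow[OF D cc] L
          cmp_sgn_pow[OF D ba(1) b] cmp_sgn_pow[OF D bb(1)[unfolded ab] a]) (simp add: sgn_pow_def)
  next
    case 4
    show ?thesis
    proof (cases "length as = 3")
      case True
      then obtain h b a where as: "as = [h, b, a]" by (auto simp: numeral_3_eq_3 length_Suc_conv)
      with c have a: "a \<in> arrows D" and b: "b \<in> arrows D" and h: "h \<in> arrows D"
        and ab: "src b = tgt a" and bh: "src h = tgt b"
        by (simp_all add: composable_Cons)
      note ba = cmp_closed[OF D b a ab, unfolded cmp_arr_def]
      note hb = cmp_closed[OF D h b bh, unfolded cmp_arr_def]
      note L = cmp_assoc[OF D h b a bh ab, unfolded cmp_arr_def]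
      \<comment> \<open>Only (2, 0) and (2, 1) survive, with opposite signs. For m = 1 the outer map
        has three inputs; (3, 0) is d applied to the zero value of the inner ternary map, which is
        the case covered here.\<close>
      have z: "bd D (Arr (src a) (tgt h) j 0) = 0" for j
        using a h by (intro bd_zero[OF D]) (simp_all add: arrows_def)
      show ?thesis using as ab bh
        by (simp add: I3[simplified] mu_arr_ainf_of_dg cmp_sgn_pow[OF D ba h] cmp_sgn_pow[OF D hb[unfolded ab] a] ab L[unfolded ab bh])
           (simp add: mu_arr_def z sgn_pow_def ab bh)
    next
      case False
      with 4 have d: "4 \<le> length as" by simp
      have "?t m n = 0" if mn: "1 \<le> m" "m + n \<le> length as" for m n
      proof -
        define p where "p = length as - m - n"
        let ?u = "take p as" and ?v = "take m (drop p as)" and ?w = "drop (length as - n) as"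
        \<comment> \<open>The definition places the right cut at d - n, whereas the middle block
          ends at p + m; their equality makes the three blocks concatenate to
          \<open>as\<close>.\<close>
        have "length as - n = m + p" using mn by (simp add: p_def)
        then have "?w = drop m (drop p as)" by (simp add: add.commute)
        then have "?u @ ?v @ ?w = as" by (simp only: append_take_drop_id)
        then have "composable D (?u @ ?v @ ?w)" using c by (rule ssubst)
        moreover have "?v \<noteq> []" "4 \<le> length ?u + length ?v + length ?w"
          using mn d by (auto simp: p_def)
        ultimately have "mu ?A (?u @ [mu_arr ?A ?v] @ ?w) = 0"
          by (rule mu_ainf_of_dg_inner[OF D])
        then show ?thesis by (simp add: Let_def p_def)
      qed
      then show ?thesis by (intro sum.neutral) auto
    qed
  qed
qed

lemma strictly_unital_ainf_of_dg:
  assumes D: "dg_category D"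
  shows "strictly_unital (ainf_of_dg D)"
  unfolding strictly_unital_def
  by (auto simp: bd_ident[OF D] cmp_ident[OF D] mu_ainf_of_dg_higher) (simp add: sgn_pow_def)

theorem ainf_category_ainf_of_dg:
  assumes "dg_category D"
  shows "ainf_category (ainf_of_dg D)"
  using mu_arr_ainf_of_dg_in_arrows[OF assms] mu_multilinear_ainf_of_dg[OF assms]
    ainf_relations_ainf_of_dg[OF assms] strictly_unital_ainf_of_dg[OF assms]
  by (simp add: ainf_category_def dg_category_graded[OF assms])

text \<open>Degrees are preserved and morphism maps are linear, so the signs in arities one and two
  agree on both sides and cancel. In higher arities both sides are zero arrows with the same ends
  and degree.\<close>

theorem ainf_functor_ainf_of_dg_iff:
  assumes C: "dg_category C" and D: "dg_category D"
  shows "ainf_functor (ainf_of_dg C) (ainf_of_dg D) F \<longleftrightarrow> dg_functor C D F"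
proof (cases "gfunctor C D F")
  case G: True
  note gC = dg_category_graded[OF C]
  let ?M = "\<lambda>as. mu_arr (ainf_of_dg D) (map (fmap F) as) = fmap F (mu_arr (ainf_of_dg C) as)"
  have sgn_inj: "sgn_pow j u = sgn_pow j v \<longleftrightarrow> u = v" for j and u v :: 'e
    by (simp add: sgn_pow_def)
  have one: "?M [f] \<longleftrightarrow> bd_arr D (fmap F f) = fmap F (bd_arr C f)" if f: "f \<in> arrows C" for f
  proof -
    have "fmor F (src f) (tgt f) (deg f + 1) (sgn_pow (deg f) (bd C f))
        = sgn_pow (deg f) (fmor F (src f) (tgt f) (deg f + 1) (bd C f))"
      using bd_closed(1)[OF C f] by (intro gfunctor_sgn_pow[OF gC G]) (simp_all add: arrows_def)
    then show ?thesis
      by (simp add: mu_arr_ainf_of_dg bd_arr_def fmap_def sgn_inj)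
  qed
  have two: "?M [f, g] \<longleftrightarrow> cmp_arr D (fmap F f) (fmap F g) = fmap F (cmp_arr C f g)"
    if f: "f \<in> arrows C" "g \<in> arrows C" "src f = tgt g" for f g
  proof -
    have "fmor F (src g) (tgt f) (deg f + deg g) (sgn_pow (deg g) (cmp C f g))
        = sgn_pow (deg g) (fmor F (src g) (tgt f) (deg f + deg g) (cmp C f g))"
      using cmp_closed[OF C f] by (intro gfunctor_sgn_pow[OF gC G]) (simp_all add: arrows_def)
    then show ?thesis
      by (simp add: mu_arr_ainf_of_dg cmp_arr_def fmap_def sgn_inj)
  qed
  have many: "?M as" if "composable C as" "3 \<le> length as" for as
  proof -
    from that have "as \<noteq> []" by auto
    then show ?thesis
      using composable_ends[OF that(1)] that(2)
      by (simp add: mu_arr_def mu_ainf_of_dg_higher fmap_def gfunctor_zero[OF gC G] last_map hd_map o_def)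
  qed
  show ?thesis
  proof
    assume "ainf_functor (ainf_of_dg C) (ainf_of_dg D) F"
    then have M: "?M as" if "composable C as" for as using that by (simp add: ainf_functor_def)
    show "dg_functor C D F"
      unfolding dg_functor_def
      by (intro conjI G ballI impI one[THEN iffD1] two[THEN iffD1] M) (simp_all add: composable_Cons)
  next
    assume F: "dg_functor C D F"
    have "?M as" if c: "composable C as" for as
    proof (cases as rule: list_short_cases)
      case 1
      with c show ?thesis by (simp add: composable_def)
    next
      case (2 a)
      with c F show ?thesis
        using one[of a] by (simp add: dg_functor_def composable_Cons)
    next
      case (3 b a)
      with c F show ?thesis
        using two[of b a] by (simp add: dg_functor_def composable_Cons)
    qed (rule many[OF c])
    with G show "ainf_functor (ainf_of_dg C) (ainf_of_dg D) F" by (simp add: ainf_functor_def)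
  qed
qed (simp add: ainf_functor_def dg_functor_def)

section \<open>Groups of invertible endofunctors\<close>

lemma fmap_frestrict:
  assumes "a \<in> arrows C"
  shows "fmap (frestrict C F) a = fmap F a"
  using assms by (cases a) (simp add: fmap_def frestrict_def arrows_def)

lemma fob_frestrict:
  assumes "X \<in> Ob C"
  shows "fob (frestrict C F) X = fob F X"
  using assms by (simp add: frestrict_def)

lemma frestrict_idem [simp]: "frestrict C (frestrict C F) = frestrict C F"
  by (simp add: frestrict_def fun_eq_iff)

text \<open>Off the category both restrictions take the same default value. The group laws for
  functors are equalities of records, and this reduces them to values on objects and
  morphisms.\<close>

lemma frestrict_eqI:
  assumes "\<And>X. X \<in> Ob C \<Longrightarrow> fob F X = fob G X"
    and "\<And>a. a \<in> arrows C \<Longrightarrow> fmap F a = fmap G a"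
  shows "frestrict C F = frestrict C G"
proof -
  have "fmor F X Y i x = fmor G X Y i x" if "Arr X Y i x \<in> arrows C" for X Y i x
    using assms(2)[OF that] by (simp add: fmap_def)
  with assms(1) show ?thesis by (auto simp: frestrict_def fun_eq_iff restrict_def)
qed

lemma fob_fun_comp:
  assumes "X \<in> Ob C"
  shows "fob (fun_comp C G F) X = fob G (fob F X)"
  using assms by (simp add: fun_comp_def fob_frestrict)

lemma fmap_fun_comp:
  assumes "a \<in> arrows C"
  shows "fmap (fun_comp C G F) a = fmap G (fmap F a)"
  using assms by (simp add: fun_comp_def fmap_frestrict) (simp add: fmap_def)

lemma fob_fun_id:
  assumes "X \<in> Ob C"
  shows "fob (fun_id C) X = X"
  using assms by (simp add: fun_id_def fob_frestrict)

lemma fmap_fun_id: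
  assumes "a \<in> arrows C"
  shows "fmap (fun_id C) a = a"
  using assms by (simp add: fun_id_def fmap_frestrict) (simp add: fmap_def)

lemma gfunctorI:
  assumes "\<And>X. X \<in> Ob C \<Longrightarrow> fob F X \<in> Ob D"
    and "\<And>a. a \<in> arrows C \<Longrightarrow> fmap F a \<in> arrows D"
    and "\<And>X Y i x y. Arr X Y i x \<in> arrows C \<Longrightarrow> Arr X Y i y \<in> arrows C \<Longrightarrow>
      fmor F X Y i (x + y) = fmor F X Y i x + fmor F X Y i y"
    and "\<And>X Y i x c. Arr X Y i x \<in> arrows C \<Longrightarrow>
      fmor F X Y i (scl C c x) = scl D c (fmor F X Y i x)"
    and "\<And>X. X \<in> Ob C \<Longrightarrow> fmap F (ident_arr C X) = ident_arr D (fob F X)"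
    and C: "graded_cat C"
  shows "gfunctor C D (frestrict C F)"
proof -
  have "fmor (frestrict C F) X Y i x = fmor F X Y i x" if "Arr X Y i x \<in> arrows C" for X Y i x
    using that by (simp add: frestrict_def)
  \<comment> \<open>Additivity is claimed for the restricted map, which is \<open>undefined\<close>
    unless the sum and the multiple are themselves morphisms.\<close>
  moreover have "Arr X Y i (x + y) \<in> arrows C" "Arr X Y i (scl C c x) \<in> arrows C"
    if "Arr X Y i x \<in> arrows C" "Arr X Y i y \<in> arrows C" for X Y i x y c
    using that graded_cat_subspace(2,3)[OF C] by (simp_all add: Arr_in_arrows)
  ultimately show ?thesis
    unfolding gfunctor_def
    by (auto simp: fob_frestrict fmap_frestrict assms ident_arr_in_arrows[OF C])
qed

lemma gfunctor_fun_id: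
  assumes "graded_cat C"
  shows "gfunctor C C (fun_id C)"
  unfolding fun_id_def using assms by (intro gfunctorI) (simp_all add: fmap_def ident_arr_def)

lemma gfunctor_fun_comp:
  assumes C: "graded_cat C" and G: "gfunctor C C G" and F: "gfunctor C C F"
  shows "gfunctor C C (fun_comp C G F)"
  unfolding fun_comp_def
proof (rule gfunctorI)
  fix a assume "a \<in> arrows C"
  from gfunctor_map[OF G gfunctor_map[OF F this]]
  show "fmap \<lparr>fob = \<lambda>X. fob G (fob F X),
      fmor = \<lambda>X Y i a. fmor G (fob F X) (fob F Y) i (fmor F X Y i a)\<rparr> a \<in> arrows C"
    by (simp add: fmap_def)
next
  fix X assume X: "X \<in> Ob C"
  have "fmap G (fmap F (ident_arr C X)) = ident_arr C (fob G (fob F X))"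
    using X G F by (simp add: gfunctor_def)
  then show "fmap \<lparr>fob = \<lambda>X. fob G (fob F X),
      fmor = \<lambda>X Y i a. fmor G (fob F X) (fob F Y) i (fmor F X Y i a)\<rparr> (ident_arr C X)
    = ident_arr C (fob \<lparr>fob = \<lambda>X. fob G (fob F X),
      fmor = \<lambda>X Y i a. fmor G (fob F X) (fob F Y) i (fmor F X Y i a)\<rparr> X)"
    by (simp add: fmap_def)
qed (use C in \<open>simp_all add: Arr_in_arrows gfunctor_ob[OF F] gfunctor_ob[OF G] gfunctor_hom[OF F]
      gfunctor_add[OF F] gfunctor_add[OF G] gfunctor_scale[OF F] gfunctor_scale[OF G]\<close>)

lemma dg_functor_fun_id:
  assumes "dg_category C"
  shows "dg_functor C C (fun_id C)"
  using assms
  by (simp add: dg_functor_def gfunctor_fun_id dg_category_graded fmap_fun_id bd_closed cmp_closed)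

lemma dg_functor_fun_comp:
  assumes "dg_category C" "dg_functor C C G" "dg_functor C C F"
  shows "dg_functor C C (fun_comp C G F)"
  using assms gfunctor_map[of C C F]
  by (simp add: dg_functor_def gfunctor_fun_comp dg_category_graded fmap_fun_comp bd_closed cmp_closed)

lemma gfunctor_frestrict: "gfunctor C D F \<Longrightarrow> frestrict C F = F"
  by (simp add: gfunctor_def)

text \<open>The innermost functor must land in the category, since the bracketed composite is
  evaluated at its values and is \<open>undefined\<close> elsewhere.\<close>

lemma fun_comp_assoc:
  assumes F: "gfunctor C C F"
  shows "fun_comp C (fun_comp C H G) F = fun_comp C H (fun_comp C G F)"
proof -
  have "frestrict C (fun_comp C (fun_comp C H G) F) = frestrict C (fun_comp C H (fun_comp C G F))"
    by (rule frestrict_eqI)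
      (simp_all add: fob_fun_comp fmap_fun_comp gfunctor_ob[OF F] gfunctor_map[OF F])
  then show ?thesis by (simp add: fun_comp_def)
qed

lemma fun_comp_id:
  assumes F: "gfunctor C C F"
  shows "fun_comp C (fun_id C) F = F" "fun_comp C F (fun_id C) = F"
proof -
  have "frestrict C (fun_comp C (fun_id C) F) = frestrict C F"
    "frestrict C (fun_comp C F (fun_id C)) = frestrict C F"
    by (rule frestrict_eqI; simp add: fob_fun_comp fmap_fun_comp fob_fun_id fmap_fun_id
        gfunctor_ob[OF F] gfunctor_map[OF F])+
  then show "fun_comp C (fun_id C) F = F" "fun_comp C F (fun_id C) = F"
    using gfunctor_frestrict[OF F] by (simp_all add: fun_comp_def)
qed

text \<open>The usual argument for units of a monoid: F G is inverted by G' F'.\<close>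

lemma group_invertibles:
  assumes gf: "\<And>F. F \<in> E \<Longrightarrow> gfunctor C C F"
    and one: "fun_id C \<in> E"
    and mult: "\<And>F G. F \<in> E \<Longrightarrow> G \<in> E \<Longrightarrow> fun_comp C G F \<in> E"
  shows "group (invertibles C E)"
proof (rule groupI)
  note ids = fun_comp_id[OF gf]
  show "\<one>\<^bsub>invertibles C E\<^esub> \<in> carrier (invertibles C E)"
    using one ids[OF one] by (auto simp: invertibles_def)
  fix F assume "F \<in> carrier (invertibles C E)"
  then obtain F' where F: "F \<in> E" "F' \<in> E" "fun_comp C F' F = fun_id C" "fun_comp C F F' = fun_id C"
    by (auto simp: invertibles_def)
  show "\<one>\<^bsub>invertibles C E\<^esub> \<otimes>\<^bsub>invertibles C E\<^esub> F = F"
    using F ids by (simp add: invertibles_def)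
  show "\<exists>G\<in>carrier (invertibles C E). G \<otimes>\<^bsub>invertibles C E\<^esub> F = \<one>\<^bsub>invertibles C E\<^esub>"
    using F by (auto simp: invertibles_def)
  fix G assume "G \<in> carrier (invertibles C E)"
  then obtain G' where G: "G \<in> E" "G' \<in> E" "fun_comp C G' G = fun_id C" "fun_comp C G G' = fun_id C"
    by (auto simp: invertibles_def)
  \<comment> \<open>Used twice below, the second time with functors and inverses exchanged.\<close>
  have cancel: "fun_comp C (fun_comp C K' H') (fun_comp C H K) = fun_id C"
    if "H \<in> E" "K \<in> E" "H' \<in> E" "K' \<in> E" "fun_comp C H' H = fun_id C" "fun_comp C K' K = fun_id C"
    for H K H' K'
    by (metis fun_comp_assoc gf ids(1) mult that)
  have "fun_comp C (fun_comp C G' F') (fun_comp C F G) = fun_id C"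
    "fun_comp C (fun_comp C F G) (fun_comp C G' F') = fun_id C"
    using F G by (intro cancel; simp)+
  then show "F \<otimes>\<^bsub>invertibles C E\<^esub> G \<in> carrier (invertibles C E)"
    using F G mult by (auto simp: invertibles_def intro!: bexI[of _ "fun_comp C G' F'"])
  fix H assume "H \<in> carrier (invertibles C E)"
  then have "H \<in> E" by (simp add: invertibles_def)
  then show "F \<otimes>\<^bsub>invertibles C E\<^esub> G \<otimes>\<^bsub>invertibles C E\<^esub> H
      = F \<otimes>\<^bsub>invertibles C E\<^esub> (G \<otimes>\<^bsub>invertibles C E\<^esub> H)"
    by (simp add: invertibles_def fun_comp_assoc gf)
qed

lemma group_dg_Aut:
  assumes "dg_category D"
  shows "group (dg_Aut D)"
  unfolding dg_Aut_def
  by (rule group_invertibles)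
    (use assms in \<open>auto simp: dg_functor_fun_id dg_functor_fun_comp dest: dg_functor_def[THEN iffD1]\<close>)

text \<open>The skew category takes powers of F in \<open>ainf_Aut\<close>, the orbit category in
  \<open>dg_Aut\<close>. Equality of the groups makes these the same family of functors.\<close>

lemma ainf_Aut_ainf_of_dg:
  assumes "dg_category D"
  shows "ainf_Aut (ainf_of_dg D) = dg_Aut D"
proof -
  have "fun_comp (ainf_of_dg D) = fun_comp D" "fun_id (ainf_of_dg D) = fun_id D"
    by (simp_all add: fun_comp_def fun_id_def fun_eq_iff)
  then show ?thesis
    using assms by (simp add: ainf_Aut_def dg_Aut_def invertibles_def ainf_functor_ainf_of_dg_iff)
qed

section \<open>DG-categories with an additional weight grading\<close>

lemma poly_mapping_sum_single:
  assumes "finite S" "Poly_Mapping.keys f \<subseteq> S"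
  shows "(\<Sum>w\<in>S. Poly_Mapping.single w (Poly_Mapping.lookup f w)) = f"
  using assms by (intro poly_mapping_eqI) (auto simp: lookup_sum lookup_single when_def in_keys_iff)

text \<open>The sum sees only the support, but \<open>h\<close> vanishes off it, so the formula
  holds at every weight without a case split.\<close>

lemma lookup_sum_single_keys:
  assumes "\<And>w. Poly_Mapping.lookup f w = 0 \<Longrightarrow> h w = 0"
  shows "Poly_Mapping.lookup (\<Sum>w\<in>Poly_Mapping.keys f. Poly_Mapping.single w (h w)) v = h v"
  using assms by (simp add: lookup_sum lookup_single when_def in_keys_iff)

text \<open>The component keeps the formal source and target of \<open>f\<close>; how a weight
  shifts one of them is left to each instance.\<close>

definition comp_at :: "('o, 'w \<Rightarrow>\<^sub>0 'm::zero) arr \<Rightarrow> 'w \<Rightarrow> ('o, 'm) arr" where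
  "comp_at f w = Arr (src f) (tgt f) (deg f) (Poly_Mapping.lookup (val f) w)"

lemma comp_at_sel [simp]: "src (comp_at f w) = src f" "tgt (comp_at f w) = tgt f"
  "deg (comp_at f w) = deg f" "val (comp_at f w) = Poly_Mapping.lookup (val f) w"
  by (simp_all add: comp_at_def)

lemma comp_at_Arr: "comp_at (Arr X Y i f) w = Arr X Y i (Poly_Mapping.lookup f w)"
  by (simp add: comp_at_def)

text \<open>\<open>V w X Y i\<close> consists of the morphisms \<open>X \<rightarrow> Y\<close> of weight \<open>w\<close> and degree \<open>i\<close>; in \<open>arr\<close> the
  weight is not recorded, so \<open>dl\<close> (differential), \<open>gm\<close> (composition, left factor first) and \<open>H\<close> take
  it as an extra argument.\<close>

locale weighted_dg = vector_space sc
  for sc :: "'k::field \<Rightarrow> 'm::ab_group_add \<Rightarrow> 'm" +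
  fixes Obs :: "'o set"
    and V :: "'w::comm_monoid_add \<Rightarrow> 'o \<Rightarrow> 'o \<Rightarrow> int \<Rightarrow> 'm set"
    and e :: "'o \<Rightarrow> 'm"
    and dl :: "'w \<Rightarrow> ('o, 'm) arr \<Rightarrow> 'm"
    and gm :: "'w \<Rightarrow> 'w \<Rightarrow> ('o, 'm) arr \<Rightarrow> ('o, 'm) arr \<Rightarrow> 'm"
    and H :: "'w \<Rightarrow> ('o, 'm) arr set"
  assumes H_iff: "\<And>w a. a \<in> H w \<longleftrightarrow>
      src a \<in> Obs \<and> tgt a \<in> Obs \<and> val a \<in> V w (src a) (tgt a) (deg a)"
    and subspace_V: "\<And>w X Y i. X \<in> Obs \<Longrightarrow> Y \<in> Obs \<Longrightarrow> subspace (V w X Y i)"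
    and unit_V: "\<And>X. X \<in> Obs \<Longrightarrow> e X \<in> V 0 X X 0"
    and dl_closed: "\<And>w a. a \<in> H w \<Longrightarrow> dl w a \<in> V w (src a) (tgt a) (deg a + 1)"
    and dl_add: "\<And>w X Y i x y. Arr X Y i x \<in> H w \<Longrightarrow> Arr X Y i y \<in> H w \<Longrightarrow>
      dl w (Arr X Y i (x + y)) = dl w (Arr X Y i x) + dl w (Arr X Y i y)"
    and dl_scale: "\<And>w X Y i x c. Arr X Y i x \<in> H w \<Longrightarrow>
      dl w (Arr X Y i (sc c x)) = sc c (dl w (Arr X Y i x))"
    and dl_dl: "\<And>w a. a \<in> H w \<Longrightarrow> dl w (Arr (src a) (tgt a) (deg a + 1) (dl w a)) = 0"
    and gm_closed: "\<And>v w a b. b \<in> H v \<Longrightarrow> a \<in> H w \<Longrightarrow> src b = tgt a \<Longrightarrow>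
      gm v w b a \<in> V (v + w) (src a) (tgt b) (deg b + deg a)"
    and gm_add_left: "\<And>v w X Y i x y a. Arr X Y i x \<in> H v \<Longrightarrow> Arr X Y i y \<in> H v \<Longrightarrow> a \<in> H w \<Longrightarrow>
      tgt a = X \<Longrightarrow> gm v w (Arr X Y i (x + y)) a = gm v w (Arr X Y i x) a + gm v w (Arr X Y i y) a"
    and gm_add_right: "\<And>v w X Y i x y b. Arr X Y i x \<in> H w \<Longrightarrow> Arr X Y i y \<in> H w \<Longrightarrow> b \<in> H v \<Longrightarrow>
      src b = Y \<Longrightarrow> gm v w b (Arr X Y i (x + y)) = gm v w b (Arr X Y i x) + gm v w b (Arr X Y i y)"
    and gm_scale_left: "\<And>v w X Y i x c a. Arr X Y i x \<in> H v \<Longrightarrow> a \<in> H w \<Longrightarrow> tgt a = X \<Longrightarrow>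
      gm v w (Arr X Y i (sc c x)) a = sc c (gm v w (Arr X Y i x) a)"
    and gm_scale_right: "\<And>v w X Y i x c b. Arr X Y i x \<in> H w \<Longrightarrow> b \<in> H v \<Longrightarrow> src b = Y \<Longrightarrow>
      gm v w b (Arr X Y i (sc c x)) = sc c (gm v w b (Arr X Y i x))"
    and leibniz: "\<And>v w a b. b \<in> H v \<Longrightarrow> a \<in> H w \<Longrightarrow> src b = tgt a \<Longrightarrow>
      dl (v + w) (Arr (src a) (tgt b) (deg b + deg a) (gm v w b a)) =
        gm v w (Arr (src b) (tgt b) (deg b + 1) (dl v b)) a
        + sgn_pow (deg b) (gm v w b (Arr (src a) (tgt a) (deg a + 1) (dl w a)))"
    and unit_left: "\<And>w a. a \<in> H w \<Longrightarrow> gm 0 w (Arr (tgt a) (tgt a) 0 (e (tgt a))) a = val a"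
    and unit_right: "\<And>w a. a \<in> H w \<Longrightarrow> gm w 0 a (Arr (src a) (src a) 0 (e (src a))) = val a"
    and assoc: "\<And>u v w a b c. c \<in> H u \<Longrightarrow> b \<in> H v \<Longrightarrow> a \<in> H w \<Longrightarrow> src c = tgt b \<Longrightarrow> src b = tgt a \<Longrightarrow>
      gm (u + v) w (Arr (src b) (tgt c) (deg c + deg b) (gm u v c b)) a =
      gm u (v + w) c (Arr (src a) (tgt b) (deg b + deg a) (gm v w b a))"
begin

text \<open>The order of the sums and the weight w + v copy \<open>dg_orbit\<close>, so that the two
  agree by unfolding. The closure axiom writes v + w instead; commutativity of weights reconciles
  them.\<close>

definition total :: "('o, 'k, 'w \<Rightarrow>\<^sub>0 'm) dgcat" where
  "total =
     \<lparr>Ob = Obs,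
      Hom = (\<lambda>X Y i. {f. \<forall>w. Poly_Mapping.lookup f w \<in> V w X Y i}),
      scl = (\<lambda>c. Poly_Mapping.map (sc c)),
      ident = (\<lambda>X. Poly_Mapping.single 0 (e X)),
      bd = (\<lambda>f. \<Sum>w \<in> Poly_Mapping.keys (val f). Poly_Mapping.single w (dl w (comp_at f w))),
      cmp = (\<lambda>g f. \<Sum>w \<in> Poly_Mapping.keys (val f). \<Sum>v \<in> Poly_Mapping.keys (val g).
              Poly_Mapping.single (w + v) (gm v w (comp_at g v) (comp_at f w)))\<rparr>"

lemma Arr_in_H [simp]: "Arr X Y i x \<in> H w \<longleftrightarrow> X \<in> Obs \<and> Y \<in> Obs \<and> x \<in> V w X Y i"
  by (simp add: H_iff)

lemma total_sel [simp]: "Ob total = Obs"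
  "scl total c f = Poly_Mapping.map (sc c) f"
  "ident total X = Poly_Mapping.single 0 (e X)"
  "f \<in> Hom total X Y i \<longleftrightarrow> (\<forall>w. Poly_Mapping.lookup f w \<in> V w X Y i)"
  by (simp_all add: total_def)

lemma arrows_total:
  "f \<in> arrows total \<longleftrightarrow> src f \<in> Obs \<and> tgt f \<in> Obs \<and> (\<forall>w. comp_at f w \<in> H w)"
  by (auto simp: arrows_def H_iff)

lemmas V_0 = subspace_0[OF subspace_V]
  and V_add = subspace_add[OF subspace_V]
  and V_scale = subspace_scale[OF subspace_V]
  and V_sum = subspace_sum[OF subspace_V]

lemma dl_zero: "X \<in> Obs \<Longrightarrow> Y \<in> Obs \<Longrightarrow> dl w (Arr X Y i 0) = 0"
  using dl_add[of X Y i 0 w 0] by (simp add: V_0)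

lemma gm_zero_left: "X \<in> Obs \<Longrightarrow> Y \<in> Obs \<Longrightarrow> a \<in> H w \<Longrightarrow> tgt a = X \<Longrightarrow> gm v w (Arr X Y i 0) a = 0"
  using gm_add_left[of X Y i 0 v 0 a w] by (simp add: V_0)

lemma gm_zero_right: "X \<in> Obs \<Longrightarrow> Y \<in> Obs \<Longrightarrow> b \<in> H v \<Longrightarrow> src b = Y \<Longrightarrow> gm v w b (Arr X Y i 0) = 0"
  using gm_add_right[of X Y i 0 w 0 b v] by (simp add: V_0)

lemma lookup_scale: "Poly_Mapping.lookup (Poly_Mapping.map (sc c) f) w = sc c (Poly_Mapping.lookup f w)"
  by (simp add: Poly_Mapping.map.rep_eq when_def)

lemma vector_space_total: "vector_space (scl total)"
  by unfold_locales
    (auto intro!: poly_mapping_eqI simp: lookup_scale lookup_add scale_right_distrib scale_left_distrib)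

lemma graded_cat_total: "graded_cat total"
proof -
  interpret T: vector_space "scl total" by (rule vector_space_total)
  have "T.subspace (Hom total X Y i)" if "X \<in> Obs" "Y \<in> Obs" for X Y i
    using that by (intro T.subspaceI) (simp_all add: V_0 V_add V_scale lookup_add lookup_scale)
  then show ?thesis
    using vector_space_total by (simp add: graded_cat_def lookup_single when_def unit_V V_0)
qed

lemma lookup_bd_total:
  assumes "f \<in> arrows total"
  shows "Poly_Mapping.lookup (bd total f) w = dl w (comp_at f w)"
  unfolding total_def dgcat.simps
  by (rule lookup_sum_single_keys) (use assms in \<open>simp add: comp_at_def dl_zero arrows_total\<close>)

lemma bd_total_in_arrows:
  assumes "f \<in> arrows total"
  shows "bd_arr total f \<in> arrows total"
  using assms dl_closed[of "comp_at f _"]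
  by (simp add: arrows_total comp_at_Arr lookup_bd_total bd_arr_def)

section \<open>Bilinearity and closure of composition in the totalisation\<close>

text \<open>Zero components contribute nothing, so the ranges may be enlarged. The sums for x, y and
  x + y then share one range although their supports differ.\<close>

lemma cmp_total_eq_sum:
  assumes f: "f \<in> arrows total" and g: "g \<in> arrows total" and gf: "src g = tgt f"
    and fin: "finite L" "finite M"
    and sub: "Poly_Mapping.keys (val f) \<subseteq> L" "Poly_Mapping.keys (val g) \<subseteq> M"
  shows "cmp total g f
    = (\<Sum>w\<in>L. \<Sum>v\<in>M. Poly_Mapping.single (w + v) (gm v w (comp_at g v) (comp_at f w)))"
proof -
  have f0: "gm v w (comp_at g v) (comp_at f w) = 0" if "w \<notin> Poly_Mapping.keys (val f)" for v w
    using that f g gf by (simp add: comp_at_def[of f] in_keys_iff gm_zero_right arrows_total)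
  have g0: "gm v w (comp_at g v) (comp_at f w) = 0" if "v \<notin> Poly_Mapping.keys (val g)" for v w
    using that f g gf by (simp add: comp_at_def[of g] in_keys_iff gm_zero_left arrows_total)
  show ?thesis
    unfolding total_def dgcat.simps
    by (intro sum.mono_neutral_cong_left fin sub) (auto simp: f0 g0)
qed

lemma cmp_total_add_left:
  assumes "Arr Y Z j x \<in> arrows total" "Arr Y Z j y \<in> arrows total" "f \<in> arrows total" "tgt f = Y"
  shows "cmp total (Arr Y Z j (x + y)) f = cmp total (Arr Y Z j x) f + cmp total (Arr Y Z j y) f"
proof -
  let ?L = "Poly_Mapping.keys (val f)" and ?M = "Poly_Mapping.keys x \<union> Poly_Mapping.keys y"
  have "Arr Y Z j (x + y) \<in> arrows total"
    using assms by (simp add: arrows_total comp_at_Arr lookup_add V_add)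
  with assms show ?thesis
    using keys_add[of x y]
    by (simp add: cmp_total_eq_sum[where L = ?L and M = ?M] comp_at_Arr lookup_add gm_add_left
        arrows_total single_add sum.distrib)
qed

lemma cmp_total_add_right:
  assumes "Arr X Y j x \<in> arrows total" "Arr X Y j y \<in> arrows total" "g \<in> arrows total" "src g = Y"
  shows "cmp total g (Arr X Y j (x + y)) = cmp total g (Arr X Y j x) + cmp total g (Arr X Y j y)"
proof -
  let ?M = "Poly_Mapping.keys (val g)" and ?L = "Poly_Mapping.keys x \<union> Poly_Mapping.keys y"
  have "Arr X Y j (x + y) \<in> arrows total"
    using assms by (simp add: arrows_total comp_at_Arr lookup_add V_add)
  with assms show ?thesis
    using keys_add[of x y]
    by (simp add: cmp_total_eq_sum[where L = ?L and M = ?M] comp_at_Arr lookup_add gm_add_right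
        arrows_total single_add sum.distrib)
qed

text \<open>An inclusion rather than an equality, because scaling by 0 empties the support.\<close>

lemma keys_scale: "Poly_Mapping.keys (Poly_Mapping.map (sc c) f) \<subseteq> Poly_Mapping.keys f"
  by (auto simp: in_keys_iff lookup_scale)

lemma scale_sum_single:
  "Poly_Mapping.map (sc c) (\<Sum>w\<in>L. \<Sum>v\<in>M. Poly_Mapping.single (k w v) (h w v))
    = (\<Sum>w\<in>L. \<Sum>v\<in>M. Poly_Mapping.single (k w v) (sc c (h w v)))"
  by (rule poly_mapping_eqI) (auto simp: lookup_scale lookup_sum lookup_single scale_sum_right when_def
      intro!: sum.cong)

lemma cmp_total_scale_left:
  assumes "Arr Y Z j x \<in> arrows total" "f \<in> arrows total" "tgt f = Y"
  shows "cmp total (Arr Y Z j (scl total c x)) f = scl total c (cmp total (Arr Y Z j x) f)"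
proof -
  let ?L = "Poly_Mapping.keys (val f)" and ?M = "Poly_Mapping.keys x"
  have "Arr Y Z j (Poly_Mapping.map (sc c) x) \<in> arrows total"
    using assms by (simp add: arrows_total comp_at_Arr lookup_scale V_scale)
  with assms show ?thesis
    using keys_scale[of c x]
    by (simp add: cmp_total_eq_sum[where L = ?L and M = ?M] comp_at_Arr lookup_scale gm_scale_left
        arrows_total scale_sum_single)
qed

lemma cmp_total_scale_right:
  assumes "Arr X Y j x \<in> arrows total" "g \<in> arrows total" "src g = Y"
  shows "cmp total g (Arr X Y j (scl total c x)) = scl total c (cmp total g (Arr X Y j x))"
proof -
  let ?M = "Poly_Mapping.keys (val g)" and ?L = "Poly_Mapping.keys x"
  have "Arr X Y j (Poly_Mapping.map (sc c) x) \<in> arrows total"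
    using assms by (simp add: arrows_total comp_at_Arr lookup_scale V_scale)
  with assms show ?thesis
    using keys_scale[of c x]
    by (simp add: cmp_total_eq_sum[where L = ?L and M = ?M] comp_at_Arr lookup_scale gm_scale_right
        arrows_total scale_sum_single)
qed

lemma cmp_total_in_arrows:
  assumes f: "f \<in> arrows total" and g: "g \<in> arrows total" and gf: "src g = tgt f"
  shows "cmp_arr total g f \<in> arrows total"
proof -
  have ob: "src f \<in> Obs" "tgt g \<in> Obs" using f g by (simp_all add: arrows_total)
  have "gm v w (comp_at g v) (comp_at f w) \<in> V (w + v) (src f) (tgt g) (deg g + deg f)" for v w
    using gm_closed[of "comp_at g v" v "comp_at f w" w] f g gf
    by (simp add: arrows_total add.commute[of w])
  then show ?thesis
    unfolding cmp_arr_def total_def dgcat.simps using ob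
    by (auto simp: arrows_def lookup_sum lookup_single when_def intro!: V_sum V_0)
qed

section \<open>Reduction to morphisms of a single weight\<close>

lemma single_in_arrows [simp]:
  "Arr X Y i (Poly_Mapping.single w x) \<in> arrows total \<longleftrightarrow> X \<in> Obs \<and> Y \<in> Obs \<and> x \<in> V w X Y i"
  by (force simp: arrows_def lookup_single when_def V_0)

lemma cmp_total_single:
  assumes "X \<in> Obs" "Y \<in> Obs" "Z \<in> Obs" "x \<in> V w X Y i" "y \<in> V v Y Z j"
  shows "cmp total (Arr Y Z j (Poly_Mapping.single v y)) (Arr X Y i (Poly_Mapping.single w x))
    = Poly_Mapping.single (w + v) (gm v w (Arr Y Z j y) (Arr X Y i x))"
  using assms by (subst cmp_total_eq_sum[where L = "{w}" and M = "{v}"]) (simp_all add: comp_at_Arr)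

lemma bd_total_single:
  assumes "X \<in> Obs" "Y \<in> Obs" "x \<in> V w X Y i"
  shows "bd total (Arr X Y i (Poly_Mapping.single w x)) = Poly_Mapping.single w (dl w (Arr X Y i x))"
  using assms
  by (intro poly_mapping_eqI) (simp add: lookup_bd_total comp_at_Arr lookup_single when_def dl_zero)

lemma bd_total_add:
  assumes "Arr X Y i x \<in> arrows total" "Arr X Y i y \<in> arrows total"
  shows "bd total (Arr X Y i (x + y)) = bd total (Arr X Y i x) + bd total (Arr X Y i y)"
proof -
  have "Arr X Y i (x + y) \<in> arrows total"
    using assms by (simp add: arrows_total comp_at_Arr lookup_add V_add)
  with assms show ?thesis
    by (intro poly_mapping_eqI)
      (simp add: lookup_bd_total comp_at_Arr lookup_add, simp add: dl_add arrows_total comp_at_Arr)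
qed

text \<open>A morphism is the finite sum of its weight components. Multiadditive identities can thus
  be checked one weight at a time, which avoids manipulating nested sums.\<close>

lemma total_hom_induct [consumes 1, case_names single add]:
  assumes f: "Arr X Y i f \<in> arrows total"
    and single: "\<And>w x. x \<in> V w X Y i \<Longrightarrow> P (Poly_Mapping.single w x)"
    and add: "\<And>f g. Arr X Y i f \<in> arrows total \<Longrightarrow> Arr X Y i g \<in> arrows total \<Longrightarrow> P f \<Longrightarrow> P g \<Longrightarrow> P (f + g)"
  shows "P f"
proof -
  have ob: "X \<in> Obs" "Y \<in> Obs" and x: "Poly_Mapping.lookup f w \<in> V w X Y i" for w
    using f by (simp_all add: arrows_def)
  \<comment> \<open>The zero morphism is the zero component in weight 0; it provides the empty
    sum.\<close>
  have "P 0" using single[of 0 0] ob by (simp add: V_0)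
  \<comment> \<open>Membership is carried through the induction because \<open>add\<close> asks for
    it on both summands.\<close>
  have "Arr X Y i (\<Sum>w\<in>S. Poly_Mapping.single w (Poly_Mapping.lookup f w)) \<in> arrows total \<and>
    P (\<Sum>w\<in>S. Poly_Mapping.single w (Poly_Mapping.lookup f w))" if "finite S" for S
    using that
  proof (induction S)
    case empty
    show ?case using ob \<open>P 0\<close> by (simp add: arrows_def V_0)
  next
    case (insert w S)
    let ?s = "Poly_Mapping.single w (Poly_Mapping.lookup f w)"
    let ?r = "\<Sum>w\<in>S. Poly_Mapping.single w (Poly_Mapping.lookup f w)"
    have s: "Arr X Y i ?s \<in> arrows total" using ob x by simp
    from insert have r: "Arr X Y i ?r \<in> arrows total" and "P ?r" by auto
    with s have "Arr X Y i (?s + ?r) \<in> arrows total" by (simp add: arrows_def lookup_add V_add)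
    moreover have "P (?s + ?r)" by (rule add[OF s r single[OF x] \<open>P ?r\<close>])
    ultimately show ?case using insert by simp
  qed
  from this[of "Poly_Mapping.keys f"] show ?thesis by (simp add: poly_mapping_sum_single)
qed

lemma Arr_cmp_total_in_arrows:
  assumes "Arr Y Z j g \<in> arrows total" "Arr X Y i f \<in> arrows total"
  shows "Arr X Z (j + i) (cmp total (Arr Y Z j g) (Arr X Y i f)) \<in> arrows total"
  using cmp_total_in_arrows[OF assms(2,1)] by (simp add: cmp_arr_def)

lemma Arr_bd_total_in_arrows:
  assumes "Arr X Y i f \<in> arrows total"
  shows "Arr X Y (i + 1) (bd total (Arr X Y i f)) \<in> arrows total"
  using bd_total_in_arrows[OF assms] by (simp add: bd_arr_def)

lemma arrows_obs: "Arr X Y i f \<in> arrows total \<Longrightarrow> X \<in> Obs \<and> Y \<in> Obs"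
  by (simp add: arrows_def)

text \<open>Both sides are additive in each factor, so three nested inductions leave single weights,
  where the locale axiom \<open>assoc\<close> applies.\<close>

lemma cmp_total_assoc:
  assumes h: "Arr Y Z k h \<in> arrows total" and g: "Arr X Y j g \<in> arrows total"
    and f: "Arr W X i f \<in> arrows total"
  shows "cmp total (Arr X Z (k + j) (cmp total (Arr Y Z k h) (Arr X Y j g))) (Arr W X i f)
    = cmp total (Arr Y Z k h) (Arr W Y (j + i) (cmp total (Arr X Y j g) (Arr W X i f)))"
  using h
proof (induction rule: total_hom_induct)
  case (add h h')
  then show ?case using g f
    by (simp add: cmp_total_add_left Arr_cmp_total_in_arrows)
next
  case h: (single w h)
  have h': "Arr Y Z k (Poly_Mapping.single w h) \<in> arrows total" using h arrows_obs[OF assms(1)] by simp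
  from g show ?case
  proof (induction rule: total_hom_induct)
    case (add g g')
    then show ?case using f h'
      by (simp add: cmp_total_add_left cmp_total_add_right Arr_cmp_total_in_arrows del: single_in_arrows)
  next
    case g: (single v g)
    have g': "Arr X Y j (Poly_Mapping.single v g) \<in> arrows total" using g arrows_obs[OF assms(2)] by simp
    from f show ?case
    proof (induction rule: total_hom_induct)
      case (add f f')
      then show ?case using g' h'
        by (simp add: cmp_total_add_left cmp_total_add_right Arr_cmp_total_in_arrows del: single_in_arrows)
    next
      case f: (single u f)
      have ob: "W \<in> Obs" "X \<in> Obs" "Y \<in> Obs" "Z \<in> Obs"
        using arrows_obs assms by blast+
      have "gm w v (Arr Y Z k h) (Arr X Y j g) \<in> V (v + w) X Z (k + j)"
        "gm v u (Arr X Y j g) (Arr W X i f) \<in> V (u + v) W Y (j + i)"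
        using gm_closed[of "Arr Y Z k h" w "Arr X Y j g" v]
          gm_closed[of "Arr X Y j g" v "Arr W X i f" u] ob f g h by (simp_all add: add.commute)
      then show ?case
        using ob f g h assoc[of "Arr Y Z k h" w "Arr X Y j g" v "Arr W X i f" u]
        by (simp add: cmp_total_single add.commute[of w v] add.commute[of v u] add.commute[of w "u + v"] add.assoc)
    qed
  qed
qed

text \<open>The sign depends on the degree only, not on the weight, so both sides are additive in
  each factor and single weights suffice.\<close>

lemma bd_total_cmp:
  assumes g: "Arr Y Z j g \<in> arrows total" and f: "Arr X Y i f \<in> arrows total"
  shows "bd total (Arr X Z (j + i) (cmp total (Arr Y Z j g) (Arr X Y i f)))
    = cmp total (Arr Y Z (j + 1) (bd total (Arr Y Z j g))) (Arr X Y i f)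
      + sgn_pow j (cmp total (Arr Y Z j g) (Arr X Y (i + 1) (bd total (Arr X Y i f))))"
  using g
proof (induction rule: total_hom_induct)
  case (add g g')
  then show ?case using f
    by (simp add: cmp_total_add_left bd_total_add Arr_cmp_total_in_arrows Arr_bd_total_in_arrows sgn_pow_def)
next
  case g: (single v g)
  have g': "Arr Y Z j (Poly_Mapping.single v g) \<in> arrows total" using g arrows_obs[OF assms(1)] by simp
  from f show ?case
  proof (induction rule: total_hom_induct)
    case (add f f')
    then show ?case using g'
      by (simp add: cmp_total_add_right bd_total_add Arr_cmp_total_in_arrows Arr_bd_total_in_arrows sgn_pow_def
          del: single_in_arrows)
  next
    case f: (single u f)
    have ob: "X \<in> Obs" "Y \<in> Obs" "Z \<in> Obs"
      using arrows_obs assms by blast+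
    have "gm v u (Arr Y Z j g) (Arr X Y i f) \<in> V (u + v) X Z (j + i)"
      "dl u (Arr X Y i f) \<in> V u X Y (i + 1)" "dl v (Arr Y Z j g) \<in> V v Y Z (j + 1)"
      using gm_closed[of "Arr Y Z j g" v "Arr X Y i f" u]
        dl_closed[of "Arr X Y i f" u] dl_closed[of "Arr Y Z j g" v] ob f g
      by (simp_all add: add.commute)
    then show ?case
      using ob f g leibniz[of "Arr Y Z j g" v "Arr X Y i f" u]
      by (simp add: cmp_total_single bd_total_single add.commute[of u v] single_add)
        (simp add: sgn_pow_def single_uminus)
  qed
qed

theorem dg_category_total: "dg_category total"
  unfolding dg_category_def
proof (intro conjI ballI impI)
  show "graded_cat total" by (rule graded_cat_total)
  show "bd_linear total"
    unfolding bd_linear_def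
  proof (intro allI impI conjI)
    fix X Y i x y c assume xy: "Arr X Y i x \<in> arrows total \<and> Arr X Y i y \<in> arrows total"
    then show "bd total (Arr X Y i (x + y)) = bd total (Arr X Y i x) + bd total (Arr X Y i y)"
      by (simp add: bd_total_add)
    from xy have "Arr X Y i (scl total c x) \<in> arrows total"
      by (simp add: arrows_def lookup_scale V_scale)
    with xy show "bd total (Arr X Y i (scl total c x)) = scl total c (bd total (Arr X Y i x))"
      by (intro poly_mapping_eqI)
        (simp add: lookup_bd_total comp_at_Arr lookup_scale, simp add: dl_scale arrows_total comp_at_Arr)
  qed
  show "cmp_bilinear total"
    unfolding cmp_bilinear_def
    by (auto simp: cmp_total_add_left cmp_total_add_right cmp_total_scale_left cmp_total_scale_right
        simp del: total_sel)
next
  fix f assume f: "f \<in> arrows total"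
  show bf: "bd_arr total f \<in> arrows total" by (rule bd_total_in_arrows[OF f])
  show "bd total (bd_arr total f) = 0"
    using f dl_dl[of "comp_at f _"]
    by (intro poly_mapping_eqI)
      (simp add: lookup_bd_total[OF bf], simp add: bd_arr_def comp_at_Arr lookup_bd_total arrows_total)
  let ?K = "Poly_Mapping.keys (val f)"
  have id: "ident_arr total X \<in> arrows total" if "X \<in> Obs" for X
    using that by (intro ident_arr_in_arrows graded_cat_total) simp
  \<comment> \<open>The unit is supported in weight 0, so {0} is a sufficient range for its
    factor.\<close>
  have "cmp total (ident_arr total (tgt f)) f
    = (\<Sum>w\<in>?K. Poly_Mapping.single w (Poly_Mapping.lookup (val f) w))"
    using f id unit_left[of "comp_at f _"]
    by (subst cmp_total_eq_sum[where L = ?K and M = "{0}"])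
      (simp_all add: ident_arr_def arrows_total comp_at_Arr)
  then show "cmp total (ident_arr total (tgt f)) f = val f" by (simp add: poly_mapping_sum_single)
  have "cmp total f (ident_arr total (src f))
    = (\<Sum>w\<in>?K. Poly_Mapping.single w (Poly_Mapping.lookup (val f) w))"
    using f id unit_right[of "comp_at f _"]
    by (subst cmp_total_eq_sum[where L = "{0}" and M = ?K])
      (simp_all add: ident_arr_def arrows_total comp_at_Arr)
  then show "cmp total f (ident_arr total (src f)) = val f" by (simp add: poly_mapping_sum_single)
next
  fix f g assume "f \<in> arrows total" "g \<in> arrows total" "src f = tgt g"
  then show "cmp_arr total f g \<in> arrows total"
    "bd total (cmp_arr total f g)
      = cmp total (bd_arr total f) g + sgn_pow (deg f) (cmp total f (bd_arr total g))"
    using bd_total_cmp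
    by (auto simp: cmp_total_in_arrows) (cases f; cases g; simp add: cmp_arr_def bd_arr_def)
next
  fix f g h assume "f \<in> arrows total" "g \<in> arrows total" "h \<in> arrows total"
    "src f = tgt g \<and> src g = tgt h"
  then show "cmp total (cmp_arr total f g) h = cmp total f (cmp_arr total g h)"
    using cmp_total_assoc by (cases f; cases g; cases h) (simp add: cmp_arr_def)
qed

end

section \<open>Skew and orbit category of an action of the integers\<close>

text \<open>\<open>P l\<close> stands for F^l. Keeping it abstract separates the category theory
  from powers in an automorphism group; only the homomorphism laws are extracted from the
  latter.\<close>

locale dg_int_action =
  fixes A :: "('o, 'k::field, 'm::ab_group_add) dgcat"
    and P :: "int \<Rightarrow> ('o, 'm, 'o, 'm) gfun"
  assumes dg: "dg_category A"
    and P_dg: "\<And>l. dg_functor A A (P l)"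
    and P_zero: "P 0 = fun_id A"
    and P_add: "\<And>l m. P (l + m) = fun_comp A (P l) (P m)"
begin

lemma graded: "graded_cat A"
  by (rule dg_category_graded[OF dg])

lemma P_gfunctor: "gfunctor A A (P l)"
  using P_dg by (simp add: dg_functor_def)

lemmas P_ob = gfunctor_ob[OF P_gfunctor]
  and P_arrows = gfunctor_map[OF P_gfunctor]
  and P_hom = gfunctor_hom[OF P_gfunctor]
  and P_plus = gfunctor_add[OF P_gfunctor]
  and P_scale = gfunctor_scale[OF P_gfunctor]
  and P_0 = gfunctor_zero[OF graded P_gfunctor]

lemma P_bd: "f \<in> arrows A \<Longrightarrow> bd A (fmap (P l) f) = val (fmap (P l) (bd_arr A f))"
  using P_dg[of l] bd_arr_sel(4)[of A "fmap (P l) f"] unfolding dg_functor_def by metis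

lemma P_cmp: "f \<in> arrows A \<Longrightarrow> g \<in> arrows A \<Longrightarrow> src f = tgt g \<Longrightarrow>
    fmap (P l) (cmp_arr A f g) = cmp_arr A (fmap (P l) f) (fmap (P l) g)"
  using P_dg[of l] by (simp add: dg_functor_def)

lemma P_bd_arr: "f \<in> arrows A \<Longrightarrow> fmap (P l) (bd_arr A f) = bd_arr A (fmap (P l) f)"
  using P_dg[of l] by (simp add: dg_functor_def)

lemma P_ident: "X \<in> Ob A \<Longrightarrow> fmap (P l) (ident_arr A X) = ident_arr A (fob (P l) X)"
  using P_gfunctor[of l] by (simp add: gfunctor_def)

lemma fob_P_add: "X \<in> Ob A \<Longrightarrow> fob (P (l + m)) X = fob (P l) (fob (P m) X)"
  by (simp add: P_add fob_fun_comp)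

lemma fmap_P_add: "a \<in> arrows A \<Longrightarrow> fmap (P (l + m)) a = fmap (P l) (fmap (P m) a)"
  by (simp add: P_add fmap_fun_comp)

lemma fob_P_0 [simp]: "X \<in> Ob A \<Longrightarrow> fob (P 0) X = X"
  by (simp add: P_zero fob_fun_id)

lemma fmap_P_0 [simp]: "a \<in> arrows A \<Longrightarrow> fmap (P 0) a = a"
  by (simp add: P_zero fmap_fun_id)

lemma fob_P_inverse [simp]:
  assumes "X \<in> Ob A"
  shows "fob (P l) (fob (P (- l)) X) = X" "fob (P (- l)) (fob (P l) X) = X"
  using fob_P_add[OF assms, of l "- l"] fob_P_add[OF assms, of "- l" l] assms by simp_all

lemma fmap_Arr: "fmap G (Arr X Y i x) = Arr (fob G X) (fob G Y) i (fmor G X Y i x)"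
  by (simp add: fmap_def)

text \<open>A morphism X to Y of weight l in the formal sense is an arrow F^l X to Y of
  \<open>A\<close>; this recovers that arrow. \<open>orbit_at\<close> does the same for X to F^l
  Y.\<close>

definition skew_at :: "int \<Rightarrow> ('o, 'm) arr \<Rightarrow> ('o, 'm) arr" where
  "skew_at l a = Arr (fob (P l) (src a)) (tgt a) (deg a) (val a)"

definition orbit_at :: "int \<Rightarrow> ('o, 'm) arr \<Rightarrow> ('o, 'm) arr" where
  "orbit_at l a = Arr (src a) (fob (P l) (tgt a)) (deg a) (val a)"

lemma at_sel [simp]:
  "src (skew_at l a) = fob (P l) (src a)" "tgt (skew_at l a) = tgt a" "deg (skew_at l a) = deg a"
  "val (skew_at l a) = val a"
  "src (orbit_at l a) = src a" "tgt (orbit_at l a) = fob (P l) (tgt a)" "deg (orbit_at l a) = deg a"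
  "val (orbit_at l a) = val a"
  by (simp_all add: skew_at_def orbit_at_def)

lemma at_Arr [simp]:
  "skew_at l (Arr X Y i x) = Arr (fob (P l) X) Y i x"
  "orbit_at l (Arr X Y i x) = Arr X (fob (P l) Y) i x"
  by (simp_all add: skew_at_def orbit_at_def)

definition skew_hom :: "int \<Rightarrow> ('o, 'm) arr set" where
  "skew_hom l = {a. src a \<in> Ob A \<and> tgt a \<in> Ob A \<and> skew_at l a \<in> arrows A}"

definition orbit_hom :: "int \<Rightarrow> ('o, 'm) arr set" where
  "orbit_hom l = {a. src a \<in> Ob A \<and> tgt a \<in> Ob A \<and> orbit_at l a \<in> arrows A}"

lemma skew_homD:
  assumes "a \<in> skew_hom l"
  shows "src a \<in> Ob A" "tgt a \<in> Ob A" "skew_at l a \<in> arrows A"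
  using assms by (simp_all add: skew_hom_def)

lemma orbit_homD:
  assumes "a \<in> orbit_hom l"
  shows "src a \<in> Ob A" "tgt a \<in> Ob A" "orbit_at l a \<in> arrows A"
  using assms by (simp_all add: orbit_hom_def)

lemma Arr_in_skew_hom:
  "Arr X Y i x \<in> skew_hom l \<longleftrightarrow> X \<in> Ob A \<and> Y \<in> Ob A \<and> x \<in> Hom A (fob (P l) X) Y i"
  by (auto simp: skew_hom_def Arr_in_arrows P_ob)

lemma Arr_in_orbit_hom:
  "Arr X Y i x \<in> orbit_hom l \<longleftrightarrow> X \<in> Ob A \<and> Y \<in> Ob A \<and> x \<in> Hom A X (fob (P l) Y) i"
  by (auto simp: orbit_hom_def Arr_in_arrows P_ob)

text \<open>Each axiom is the axiom of \<open>A\<close> for the recovered arrows, transported by the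
  DG-functor F^m. The identity F^(m+l) = F^m F^l puts the composite in weight m + l.\<close>

sublocale skew: weighted_dg "scl A" "Ob A" "\<lambda>l X Y i. Hom A (fob (P l) X) Y i" "ident A"
  "\<lambda>l a. bd A (skew_at l a)" "\<lambda>m l b a. cmp A (skew_at m b) (fmap (P m) (skew_at l a))" skew_hom
proof (intro weighted_dg.intro weighted_dg_axioms.intro)
  show "vector_space (scl A)" using graded by (simp add: graded_cat_def)
  fix w a
  show "a \<in> skew_hom w \<longleftrightarrow>
      src a \<in> Ob A \<and> tgt a \<in> Ob A \<and> val a \<in> Hom A (fob (P w) (src a)) (tgt a) (deg a)"
    by (cases a) (simp add: Arr_in_skew_hom)
next
  fix w X Y i assume "X \<in> Ob A" "Y \<in> Ob A"
  then show "module.subspace (scl A) (Hom A (fob (P w) X) Y i)"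
    using graded P_ob by (simp add: graded_cat_def)
next
  fix X assume "X \<in> Ob A"
  then show "ident A X \<in> Hom A (fob (P 0) X) X 0"
    using graded by (simp add: graded_cat_def)
next
  fix w a assume "a \<in> skew_hom w"
  note bd_closed[OF dg skew_homD(3)[OF this]]
  then show "bd A (skew_at w a) \<in> Hom A (fob (P w) (src a)) (tgt a) (deg a + 1)"
    "bd A (skew_at w (Arr (src a) (tgt a) (deg a + 1) (bd A (skew_at w a)))) = 0"
    by (simp_all add: arrows_def bd_arr_def)
next
  fix w X Y i x y assume "Arr X Y i x \<in> skew_hom w" "Arr X Y i y \<in> skew_hom w"
  then show "bd A (skew_at w (Arr X Y i (x + y)))
      = bd A (skew_at w (Arr X Y i x)) + bd A (skew_at w (Arr X Y i y))"
    using bd_add[OF dg] by (auto dest!: skew_homD(3))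
next
  fix w X Y i x c assume "Arr X Y i x \<in> skew_hom w"
  then show "bd A (skew_at w (Arr X Y i (scl A c x))) = scl A c (bd A (skew_at w (Arr X Y i x)))"
    using bd_scale[OF dg] by (auto dest!: skew_homD(3))
next
  fix v w a b assume "b \<in> skew_hom v" "a \<in> skew_hom w" and ba: "src b = tgt a"
  note b = skew_homD[OF this(1)] and a = skew_homD[OF this(2)]
  have Pa: "fmap (P v) (skew_at w a) \<in> arrows A" by (rule P_arrows[OF a(3)])
  have m: "src (skew_at v b) = tgt (fmap (P v) (skew_at w a))" using ba by simp
  note c = cmp_closed[OF dg b(3) Pa m]
  then show "cmp A (skew_at v b) (fmap (P v) (skew_at w a))
      \<in> Hom A (fob (P (v + w)) (src a)) (tgt b) (deg b + deg a)"
    using a by (simp add: arrows_def fob_P_add)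
  \<comment> \<open>The next equations recognise the formal arrows of the locale as
    \<open>cmp_arr\<close> and \<open>bd_arr\<close> in \<open>A\<close>; what remains is the
    Leibniz rule there.\<close>
  have "skew_at (v + w) (Arr (src a) (tgt b) (deg b + deg a)
      (cmp A (skew_at v b) (fmap (P v) (skew_at w a))))
    = cmp_arr A (skew_at v b) (fmap (P v) (skew_at w a))"
    using a by (simp add: cmp_arr_def fob_P_add)
  moreover have "skew_at v (Arr (src b) (tgt b) (deg b + 1) (bd A (skew_at v b))) = bd_arr A (skew_at v b)"
    by (simp add: bd_arr_def)
  moreover have "fmap (P v) (skew_at w (Arr (src a) (tgt a) (deg a + 1) (bd A (skew_at w a))))
    = bd_arr A (fmap (P v) (skew_at w a))"
    using P_bd_arr[OF a(3)] by (simp add: bd_arr_def)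
  ultimately show "bd A (skew_at (v + w) (Arr (src a) (tgt b) (deg b + deg a)
          (cmp A (skew_at v b) (fmap (P v) (skew_at w a))))) =
        cmp A (skew_at v (Arr (src b) (tgt b) (deg b + 1) (bd A (skew_at v b))))
          (fmap (P v) (skew_at w a))
        + sgn_pow (deg b) (cmp A (skew_at v b)
            (fmap (P v) (skew_at w (Arr (src a) (tgt a) (deg a + 1) (bd A (skew_at w a))))))"
    using bd_cmp[OF dg b(3) Pa m] by simp
next
  fix v w X Y i x y a
  assume "Arr X Y i x \<in> skew_hom v" "Arr X Y i y \<in> skew_hom v" "a \<in> skew_hom w" "tgt a = X"
  then show "cmp A (skew_at v (Arr X Y i (x + y))) (fmap (P v) (skew_at w a)) =
    cmp A (skew_at v (Arr X Y i x)) (fmap (P v) (skew_at w a)) +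
    cmp A (skew_at v (Arr X Y i y)) (fmap (P v) (skew_at w a))"
    by (simp add: cmp_add[OF dg] Arr_in_skew_hom Arr_in_arrows P_ob P_arrows skew_homD)
next
  fix v w X Y i x y b
  assume "Arr X Y i x \<in> skew_hom w" "Arr X Y i y \<in> skew_hom w" "b \<in> skew_hom v" "src b = Y"
  \<comment> \<open>Ranging over the image of {x, y} treats F^v x and F^v y in one
    statement.\<close>
  moreover from this have "Arr (fob (P v) (fob (P w) X)) (fob (P v) Y) i z \<in> arrows A"
    if "z \<in> fmor (P v) (fob (P w) X) Y i ` {x, y}" for z
    using that by (auto simp: Arr_in_skew_hom Arr_in_arrows P_ob P_hom)
  ultimately show "cmp A (skew_at v b) (fmap (P v) (skew_at w (Arr X Y i (x + y)))) =
    cmp A (skew_at v b) (fmap (P v) (skew_at w (Arr X Y i x))) +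
    cmp A (skew_at v b) (fmap (P v) (skew_at w (Arr X Y i y)))"
    by (simp add: fmap_Arr Arr_in_skew_hom P_plus P_ob cmp_add[OF dg] skew_homD)
next
  fix v w X Y i x c a
  assume "Arr X Y i x \<in> skew_hom v" "a \<in> skew_hom w" "tgt a = X"
  then show "cmp A (skew_at v (Arr X Y i (scl A c x))) (fmap (P v) (skew_at w a)) =
    scl A c (cmp A (skew_at v (Arr X Y i x)) (fmap (P v) (skew_at w a)))"
    by (simp add: cmp_scale[OF dg] Arr_in_skew_hom Arr_in_arrows P_ob P_arrows skew_homD)
next
  fix v w X Y i x c b
  assume "Arr X Y i x \<in> skew_hom w" "b \<in> skew_hom v" "src b = Y"
  moreover from this have
    "Arr (fob (P v) (fob (P w) X)) (fob (P v) Y) i (fmor (P v) (fob (P w) X) Y i x) \<in> arrows A"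
    by (auto simp: Arr_in_skew_hom Arr_in_arrows P_ob P_hom)
  ultimately show "cmp A (skew_at v b) (fmap (P v) (skew_at w (Arr X Y i (scl A c x)))) =
    scl A c (cmp A (skew_at v b) (fmap (P v) (skew_at w (Arr X Y i x))))"
    by (simp add: fmap_Arr Arr_in_skew_hom P_scale P_ob cmp_scale[OF dg] skew_homD)
next
  fix w a assume "a \<in> skew_hom w"
  note a = skew_homD[OF this]
  have "skew_at 0 (Arr (tgt a) (tgt a) 0 (ident A (tgt a))) = ident_arr A (tgt (skew_at w a))"
    using a by (simp add: ident_arr_def)
  then show "cmp A (skew_at 0 (Arr (tgt a) (tgt a) 0 (ident A (tgt a)))) (fmap (P 0) (skew_at w a)) = val a"
    using a cmp_ident(1)[OF dg a(3)] by (simp add: ident_arr_def)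
  have "fmap (P w) (skew_at 0 (Arr (src a) (src a) 0 (ident A (src a)))) = ident_arr A (src (skew_at w a))"
    using a P_ident[of "src a" w] by (simp add: ident_arr_def)
  then show "cmp A (skew_at w a) (fmap (P w) (skew_at 0 (Arr (src a) (src a) 0 (ident A (src a))))) = val a"
    using cmp_ident(2)[OF dg a(3)] by simp
next
  fix u v w a b c
  assume "c \<in> skew_hom u" "b \<in> skew_hom v" "a \<in> skew_hom w" and cb: "src c = tgt b" and ba: "src b = tgt a"
  note c = skew_homD[OF this(1)] and b = skew_homD[OF this(2)] and a = skew_homD[OF this(3)]
  let ?Pb = "fmap (P u) (skew_at v b)" and ?Pa = "fmap (P v) (skew_at w a)"
  have "skew_at (u + v) (Arr (src b) (tgt c) (deg c + deg b) (cmp A (skew_at u c) ?Pb))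
      = cmp_arr A (skew_at u c) ?Pb"
    using b by (simp add: cmp_arr_def fob_P_add)
  moreover have "fmap (P u) (skew_at (v + w) (Arr (src a) (tgt b) (deg b + deg a) (cmp A (skew_at v b) ?Pa)))
      = cmp_arr A ?Pb (fmap (P u) ?Pa)"
    using a ba P_cmp[OF b(3) P_arrows[OF a(3), of v], of u] by (simp add: cmp_arr_def fob_P_add)
  \<comment> \<open>With F^(u+v) a = F^u F^v a, both bracketings involve the three arrows c, F^u b
    and F^u F^v a.\<close>
  moreover have "fmap (P (u + v)) (skew_at w a) = fmap (P u) ?Pa"
    by (rule fmap_P_add[OF a(3)])
  ultimately show "cmp A (skew_at (u + v) (Arr (src b) (tgt c) (deg c + deg b) (cmp A (skew_at u c) ?Pb)))
      (fmap (P (u + v)) (skew_at w a)) =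
    cmp A (skew_at u c)
      (fmap (P u) (skew_at (v + w) (Arr (src a) (tgt b) (deg b + deg a) (cmp A (skew_at v b) ?Pa))))"
    using cmp_assoc[OF dg c(3) P_arrows[OF b(3), of u] P_arrows[OF P_arrows[OF a(3), of v], of u]] cb ba
    by simp
qed

text \<open>Mirror image of the skew case: the left factor is now moved, by the weight l of the
  right one. The target becomes F^l F^m Z, so \<open>fob_P_add\<close> yields l + m and
  \<open>add.commute\<close> brings it to the order of the locale.\<close>

sublocale orbit: weighted_dg "scl A" "Ob A" "\<lambda>l X Y i. Hom A X (fob (P l) Y) i" "ident A"
  "\<lambda>l a. bd A (orbit_at l a)" "\<lambda>m l b a. cmp A (fmap (P l) (orbit_at m b)) (orbit_at l a)" orbit_hom
proof (intro weighted_dg.intro weighted_dg_axioms.intro)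
  show "vector_space (scl A)" using graded by (simp add: graded_cat_def)
  fix w a
  show "a \<in> orbit_hom w \<longleftrightarrow>
      src a \<in> Ob A \<and> tgt a \<in> Ob A \<and> val a \<in> Hom A (src a) (fob (P w) (tgt a)) (deg a)"
    by (cases a) (simp add: Arr_in_orbit_hom)
next
  fix w X Y i assume "X \<in> Ob A" "Y \<in> Ob A"
  then show "module.subspace (scl A) (Hom A X (fob (P w) Y) i)"
    using graded P_ob by (simp add: graded_cat_def)
next
  fix X assume "X \<in> Ob A"
  then show "ident A X \<in> Hom A X (fob (P 0) X) 0"
    using graded by (simp add: graded_cat_def)
next
  fix w a assume "a \<in> orbit_hom w"
  note bd_closed[OF dg orbit_homD(3)[OF this]]
  then show "bd A (orbit_at w a) \<in> Hom A (src a) (fob (P w) (tgt a)) (deg a + 1)"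
    "bd A (orbit_at w (Arr (src a) (tgt a) (deg a + 1) (bd A (orbit_at w a)))) = 0"
    by (simp_all add: arrows_def bd_arr_def)
next
  fix w X Y i x y assume "Arr X Y i x \<in> orbit_hom w" "Arr X Y i y \<in> orbit_hom w"
  then show "bd A (orbit_at w (Arr X Y i (x + y)))
      = bd A (orbit_at w (Arr X Y i x)) + bd A (orbit_at w (Arr X Y i y))"
    using bd_add[OF dg] by (auto dest!: orbit_homD(3))
next
  fix w X Y i x c assume "Arr X Y i x \<in> orbit_hom w"
  then show "bd A (orbit_at w (Arr X Y i (scl A c x))) = scl A c (bd A (orbit_at w (Arr X Y i x)))"
    using bd_scale[OF dg] by (auto dest!: orbit_homD(3))
next
  fix v w a b assume "b \<in> orbit_hom v" "a \<in> orbit_hom w" and ba: "src b = tgt a"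
  note b = orbit_homD[OF this(1)] and a = orbit_homD[OF this(2)]
  have Pb: "fmap (P w) (orbit_at v b) \<in> arrows A" by (rule P_arrows[OF b(3)])
  have m: "src (fmap (P w) (orbit_at v b)) = tgt (orbit_at w a)" using ba by simp
  note c = cmp_closed[OF dg Pb a(3) m]
  then show "cmp A (fmap (P w) (orbit_at v b)) (orbit_at w a)
      \<in> Hom A (src a) (fob (P (v + w)) (tgt b)) (deg b + deg a)"
    using b by (simp add: arrows_def fob_P_add add.commute[of v])
  have "orbit_at (v + w) (Arr (src a) (tgt b) (deg b + deg a)
      (cmp A (fmap (P w) (orbit_at v b)) (orbit_at w a)))
    = cmp_arr A (fmap (P w) (orbit_at v b)) (orbit_at w a)"
    using b by (simp add: cmp_arr_def fob_P_add add.commute[of v])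
  moreover have "orbit_at w (Arr (src a) (tgt a) (deg a + 1) (bd A (orbit_at w a))) = bd_arr A (orbit_at w a)"
    by (simp add: bd_arr_def)
  moreover have "fmap (P w) (orbit_at v (Arr (src b) (tgt b) (deg b + 1) (bd A (orbit_at v b))))
    = bd_arr A (fmap (P w) (orbit_at v b))"
    using P_bd_arr[OF b(3)] by (simp add: bd_arr_def)
  ultimately show "bd A (orbit_at (v + w) (Arr (src a) (tgt b) (deg b + deg a)
          (cmp A (fmap (P w) (orbit_at v b)) (orbit_at w a)))) =
        cmp A (fmap (P w) (orbit_at v (Arr (src b) (tgt b) (deg b + 1) (bd A (orbit_at v b)))))
          (orbit_at w a)
        + sgn_pow (deg b) (cmp A (fmap (P w) (orbit_at v b))
            (orbit_at w (Arr (src a) (tgt a) (deg a + 1) (bd A (orbit_at w a)))))"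
    using bd_cmp[OF dg Pb a(3) m] by simp
next
  fix v w X Y i x y a
  assume "Arr X Y i x \<in> orbit_hom v" "Arr X Y i y \<in> orbit_hom v" "a \<in> orbit_hom w" "tgt a = X"
  moreover from this have "Arr (fob (P w) X) (fob (P w) (fob (P v) Y)) i z \<in> arrows A"
    if "z \<in> fmor (P w) X (fob (P v) Y) i ` {x, y}" for z
    using that by (auto simp: Arr_in_orbit_hom Arr_in_arrows P_ob P_hom)
  ultimately show "cmp A (fmap (P w) (orbit_at v (Arr X Y i (x + y)))) (orbit_at w a) =
    cmp A (fmap (P w) (orbit_at v (Arr X Y i x))) (orbit_at w a) +
    cmp A (fmap (P w) (orbit_at v (Arr X Y i y))) (orbit_at w a)"
    by (simp add: fmap_Arr Arr_in_orbit_hom P_plus P_ob cmp_add[OF dg] orbit_homD)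
next
  fix v w X Y i x y b
  assume "Arr X Y i x \<in> orbit_hom w" "Arr X Y i y \<in> orbit_hom w" "b \<in> orbit_hom v" "src b = Y"
  then show "cmp A (fmap (P w) (orbit_at v b)) (orbit_at w (Arr X Y i (x + y))) =
    cmp A (fmap (P w) (orbit_at v b)) (orbit_at w (Arr X Y i x)) +
    cmp A (fmap (P w) (orbit_at v b)) (orbit_at w (Arr X Y i y))"
    by (simp add: cmp_add[OF dg] Arr_in_orbit_hom Arr_in_arrows P_ob P_arrows orbit_homD)
next
  fix v w X Y i x c a
  assume "Arr X Y i x \<in> orbit_hom v" "a \<in> orbit_hom w" "tgt a = X"
  moreover from this have
    "Arr (fob (P w) X) (fob (P w) (fob (P v) Y)) i (fmor (P w) X (fob (P v) Y) i x) \<in> arrows A"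
    by (auto simp: Arr_in_orbit_hom Arr_in_arrows P_ob P_hom)
  ultimately show "cmp A (fmap (P w) (orbit_at v (Arr X Y i (scl A c x)))) (orbit_at w a) =
    scl A c (cmp A (fmap (P w) (orbit_at v (Arr X Y i x))) (orbit_at w a))"
    by (simp add: fmap_Arr Arr_in_orbit_hom P_scale P_ob cmp_scale[OF dg] orbit_homD)
next
  fix v w X Y i x c b
  assume "Arr X Y i x \<in> orbit_hom w" "b \<in> orbit_hom v" "src b = Y"
  then show "cmp A (fmap (P w) (orbit_at v b)) (orbit_at w (Arr X Y i (scl A c x))) =
    scl A c (cmp A (fmap (P w) (orbit_at v b)) (orbit_at w (Arr X Y i x)))"
    by (simp add: cmp_scale[OF dg] Arr_in_orbit_hom Arr_in_arrows P_ob P_arrows orbit_homD)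
next
  fix w a assume "a \<in> orbit_hom w"
  note a = orbit_homD[OF this]
  have "orbit_at 0 (Arr (src a) (src a) 0 (ident A (src a))) = ident_arr A (src (orbit_at w a))"
    using a by (simp add: ident_arr_def)
  then show "cmp A (fmap (P 0) (orbit_at w a)) (orbit_at 0 (Arr (src a) (src a) 0 (ident A (src a)))) = val a"
    using a cmp_ident(2)[OF dg a(3)] by (simp add: ident_arr_def)
  have "fmap (P w) (orbit_at 0 (Arr (tgt a) (tgt a) 0 (ident A (tgt a)))) = ident_arr A (tgt (orbit_at w a))"
    using a P_ident[of "tgt a" w] by (simp add: ident_arr_def)
  then show "cmp A (fmap (P w) (orbit_at 0 (Arr (tgt a) (tgt a) 0 (ident A (tgt a))))) (orbit_at w a) = val a"
    using cmp_ident(1)[OF dg a(3)] by simp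
next
  fix u v w a b c
  assume "c \<in> orbit_hom u" "b \<in> orbit_hom v" "a \<in> orbit_hom w" and cb: "src c = tgt b" and ba: "src b = tgt a"
  note c = orbit_homD[OF this(1)] and b = orbit_homD[OF this(2)] and a = orbit_homD[OF this(3)]
  let ?Pc = "fmap (P v) (orbit_at u c)" and ?Pb = "fmap (P w) (orbit_at v b)"
  have "fmap (P w) (orbit_at (u + v) (Arr (src b) (tgt c) (deg c + deg b) (cmp A ?Pc (orbit_at v b))))
      = cmp_arr A (fmap (P w) ?Pc) ?Pb"
    using c cb P_cmp[OF P_arrows[OF c(3), of v] b(3), of w]
    by (simp add: cmp_arr_def fob_P_add add.commute[of u])
  moreover have "orbit_at (v + w) (Arr (src a) (tgt b) (deg b + deg a) (cmp A ?Pb (orbit_at w a)))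
      = cmp_arr A ?Pb (orbit_at w a)"
    using b by (simp add: cmp_arr_def fob_P_add add.commute[of v])
  moreover have "fmap (P (v + w)) (orbit_at u c) = fmap (P w) ?Pc"
    using fmap_P_add[OF c(3), of w v] by (simp add: add.commute)
  ultimately show "cmp A
      (fmap (P w) (orbit_at (u + v) (Arr (src b) (tgt c) (deg c + deg b) (cmp A ?Pc (orbit_at v b)))))
      (orbit_at w a) =
    cmp A (fmap (P (v + w)) (orbit_at u c))
      (orbit_at (v + w) (Arr (src a) (tgt b) (deg b + deg a) (cmp A ?Pb (orbit_at w a))))"
    using cmp_assoc[OF dg P_arrows[OF P_arrows[OF c(3), of v], of w] P_arrows[OF b(3), of w] a(3)] cb ba
    by simp
qed

end

section \<open>The skew group category as a totalisation\<close>

lemma length_listset: "xs \<in> listset Ss \<Longrightarrow> length xs = length Ss"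
  by (induction Ss arbitrary: xs) (auto simp: set_Cons_def)

lemma length_twist: "length gs = length fs \<Longrightarrow> length (twist \<rho> gs fs) = length fs"
  by (induction gs fs rule: list_induct2) simp_all

lemma sum_listset_1: "(\<Sum>xs\<in>listset [S]. h xs) = (\<Sum>x\<in>S. h [x])"
proof -
  have "listset [S] = (\<lambda>x. [x]) ` S" by (auto simp: set_Cons_def)
  then show ?thesis by (simp add: sum.reindex inj_on_def)
qed

lemma sum_listset_2: "(\<Sum>xs\<in>listset [S, T]. h xs) = (\<Sum>x\<in>S. \<Sum>y\<in>T. h [x, y])"
proof -
  have "listset [S, T] = (\<lambda>(x, y). [x, y]) ` (S \<times> T)" by (auto simp: set_Cons_def)
  then show ?thesis by (simp add: sum.reindex inj_on_def sum.cartesian_product split_def)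
qed

lemma single_sgn_pow: "Poly_Mapping.single w (sgn_pow i x) = sgn_pow i (Poly_Mapping.single w x)"
  by (simp add: sgn_pow_def single_uminus)

context dg_int_action
begin

lemma at_comp_at:
  "skew_at l (comp_at f w) = Arr (fob (P l) (src f)) (tgt f) (deg f) (Poly_Mapping.lookup (val f) w)"
  "orbit_at l (comp_at f w) = Arr (src f) (fob (P l) (tgt f)) (deg f) (Poly_Mapping.lookup (val f) w)"
  by (simp_all add: comp_at_def)

text \<open>Twisting keeps degrees, so the signs agree, and it keeps lengths, so from arity three on
  every summand is zero. The structure maps agree on all lists, which is what an equality of records
  requires.\<close>

lemma skew_eq: "skew (ainf_of_dg A) integer_group P = ainf_of_dg skew.total"
proof -
  let ?S = "skew (ainf_of_dg A) integer_group P"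
  have "mu ?S fs = mu (ainf_of_dg skew.total) fs" for fs
  proof (cases fs rule: list_short_cases)
    case 1
    then show ?thesis by (simp add: skew_def)
  next
    case (2 f)
    then show ?thesis
      by (simp add: skew_def sum_listset_1 skew.total_def sgn_pow_sum single_sgn_pow at_comp_at
          del: listset.simps)
  next
    case (3 g f)
    have "mu ?S fs = (\<Sum>v\<in>Poly_Mapping.keys (val g). \<Sum>w\<in>Poly_Mapping.keys (val f).
      sgn_pow (deg f) (Poly_Mapping.single (w + v)
        (cmp A (skew_at v (comp_at g v)) (fmap (P v) (skew_at w (comp_at f w))))))"
      using 3
      by (simp add: skew_def sum_listset_2 single_sgn_pow at_comp_at add.commute
          del: listset.simps)
    \<comment> \<open>\<open>skew\<close> sums over the left factor first, \<open>total\<close> over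
      the right one.\<close>
    also have "\<dots> = mu (ainf_of_dg skew.total) fs"
      using 3 by (subst sum.swap) (simp add: skew.total_def sgn_pow_sum)
    finally show ?thesis .
  next
    case 4
    have "mu (ainf_of_dg A) (twist P gs fs) = 0"
      if "gs \<in> listset (map (\<lambda>f. Poly_Mapping.keys (val f)) fs)" for gs
      using 4 length_listset[OF that] by (intro mu_ainf_of_dg_higher) (simp add: length_twist)
    then show ?thesis using 4 by (simp add: mu_ainf_of_dg_higher) (simp add: skew_def)
  qed
  then show ?thesis
    by (intro ainf.equality ext) (simp_all add: skew_def skew.total_def fun_eq_iff)
qed

text \<open>A component \<open>a : F\<^sup>l X \<rightarrow> Y\<close> of weight \<open>l\<close> goes to \<open>F\<^sup>-\<^sup>l a : X \<rightarrow> F\<^sup>-\<^sup>l Y\<close>, which has weight \<open>-l\<close>.\<close>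

definition phi :: "'o \<Rightarrow> 'o \<Rightarrow> int \<Rightarrow> (int \<Rightarrow>\<^sub>0 'm) \<Rightarrow> (int \<Rightarrow>\<^sub>0 'm)" where
  "phi X Y i f = (\<Sum>l\<in>Poly_Mapping.keys f. Poly_Mapping.single (- l)
     (fmor (P (- l)) (fob (P l) X) Y i (Poly_Mapping.lookup f l)))"

text \<open>The inverse of \<open>phi\<close>: a : X to F^l Y goes to F^-l a : F^-l X to Y, again of
  weight -l.\<close>

definition psi :: "'o \<Rightarrow> 'o \<Rightarrow> int \<Rightarrow> (int \<Rightarrow>\<^sub>0 'm) \<Rightarrow> (int \<Rightarrow>\<^sub>0 'm)" where
  "psi X Y i f = (\<Sum>l\<in>Poly_Mapping.keys f. Poly_Mapping.single (- l)
     (fmor (P (- l)) X (fob (P l) Y) i (Poly_Mapping.lookup f l)))"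

section \<open>Bijectivity and linearity of the comparison map\<close>

lemma lookup_reindex:
  assumes "\<And>l. h l 0 = 0"
  shows "Poly_Mapping.lookup (\<Sum>l\<in>Poly_Mapping.keys f. Poly_Mapping.single (- l) (h l (Poly_Mapping.lookup f l))) w
    = h (- w) (Poly_Mapping.lookup f (- w :: int))"
proof -
  have "- l = w \<longleftrightarrow> l = - w" for l by auto
  then show ?thesis using assms by (simp add: lookup_sum lookup_single when_def in_keys_iff)
qed

text \<open>Weight w of the image comes from weight -w, hence the functor F^w. Linearity,
  bijectivity and compatibility with d are all read off from this formula.\<close>

lemma lookup_phi:
  assumes "X \<in> Ob A" "Y \<in> Ob A"
  shows "Poly_Mapping.lookup (phi X Y i f) w
    = fmor (P w) (fob (P (- w)) X) Y i (Poly_Mapping.lookup f (- w))"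
  unfolding phi_def using assms
  by (subst lookup_reindex[where h = "\<lambda>l. fmor (P (- l)) (fob (P l) X) Y i"]) (simp_all add: P_0 P_ob)

lemma lookup_psi:
  assumes "X \<in> Ob A" "Y \<in> Ob A"
  shows "Poly_Mapping.lookup (psi X Y i f) w
    = fmor (P w) X (fob (P (- w)) Y) i (Poly_Mapping.lookup f (- w))"
  unfolding psi_def using assms
  by (subst lookup_reindex[where h = "\<lambda>l. fmor (P (- l)) X (fob (P l) Y) i"]) (simp_all add: P_0 P_ob)

text \<open>This is F^l F^-l = F^0 = id on one morphism space; it makes \<open>phi\<close> and
  \<open>psi\<close> mutually inverse.\<close>

lemma fmor_P_inverse:
  assumes "X \<in> Ob A" "Y \<in> Ob A" "x \<in> Hom A X Y i"
  shows "fmor (P l) (fob (P (- l)) X) (fob (P (- l)) Y) i (fmor (P (- l)) X Y i x) = x"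
  using fmap_P_add[of "Arr X Y i x" l "- l"] fmap_P_0[of "Arr X Y i x"] assms by (simp add: Arr_in_arrows fmap_Arr)

lemma phi_hom:
  assumes "X \<in> Ob A" "Y \<in> Ob A" "f \<in> Hom skew.total X Y i"
  shows "phi X Y i f \<in> Hom orbit.total X Y i"
  using assms P_hom[of "fob (P (- l)) X" Y "Poly_Mapping.lookup f (- l)" i l for l]
  by (simp add: lookup_phi P_ob)

lemma psi_hom:
  assumes "X \<in> Ob A" "Y \<in> Ob A" "f \<in> Hom orbit.total X Y i"
  shows "psi X Y i f \<in> Hom skew.total X Y i"
  using assms P_hom[of X "fob (P (- l)) Y" "Poly_Mapping.lookup f (- l)" i l for l]
  by (simp add: lookup_psi P_ob)

lemma bij_betw_phi:
  assumes "X \<in> Ob A" "Y \<in> Ob A"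
  shows "bij_betw (phi X Y i) (Hom skew.total X Y i) (Hom orbit.total X Y i)"
proof (rule bij_betw_byWitness[where f' = "psi X Y i"])
  show "\<forall>f\<in>Hom skew.total X Y i. psi X Y i (phi X Y i f) = f"
  proof
    fix f assume f: "f \<in> Hom skew.total X Y i"
    show "psi X Y i (phi X Y i f) = f"
      using fmor_P_inverse[of "fob (P l) X" Y "Poly_Mapping.lookup f l" i l for l] f assms
      by (intro poly_mapping_eqI) (simp add: lookup_phi lookup_psi P_ob)
  qed
  show "\<forall>f\<in>Hom orbit.total X Y i. phi X Y i (psi X Y i f) = f"
  proof
    fix f assume f: "f \<in> Hom orbit.total X Y i"
    show "phi X Y i (psi X Y i f) = f"
      using fmor_P_inverse[of X "fob (P l) Y" "Poly_Mapping.lookup f l" i l for l] f assms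
      by (intro poly_mapping_eqI) (simp add: lookup_phi lookup_psi P_ob)
  qed
qed (use assms phi_hom psi_hom in auto)

lemma phi_add:
  assumes "Arr X Y i f \<in> arrows skew.total" "Arr X Y i g \<in> arrows skew.total"
  shows "phi X Y i (f + g) = phi X Y i f + phi X Y i g"
  using assms
  by (intro poly_mapping_eqI) (simp add: lookup_phi lookup_add P_plus P_ob arrows_def)

lemma phi_scale:
  assumes "Arr X Y i f \<in> arrows skew.total"
  shows "phi X Y i (scl skew.total c f) = scl orbit.total c (phi X Y i f)"
  using assms
  by (intro poly_mapping_eqI)
    (simp add: lookup_phi skew.lookup_scale P_scale P_ob arrows_def)

lemma phi_single:
  assumes "X \<in> Ob A" "Y \<in> Ob A"
  shows "phi X Y i (Poly_Mapping.single l x)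
    = Poly_Mapping.single (- l) (fmor (P (- l)) (fob (P l) X) Y i x)"
  using assms by (auto simp: phi_def P_0 P_ob)

lemma phi_arrows:
  assumes "Arr X Y i f \<in> arrows skew.total"
  shows "Arr X Y i (phi X Y i f) \<in> arrows orbit.total"
  using assms phi_hom[of X Y f i] by (simp add: Arr_in_arrows del: skew.total_sel(4) orbit.total_sel(4))

section \<open>Compatibility with differential and composition\<close>

text \<open>Neither differential mixes weights, so it suffices that F^w commutes with d on each
  component.\<close>

lemma phi_bd:
  assumes f: "Arr X Y i f \<in> arrows skew.total"
  shows "bd orbit.total (Arr X Y i (phi X Y i f)) = phi X Y (i + 1) (bd skew.total (Arr X Y i f))"
proof (rule poly_mapping_eqI)
  fix w
  have ob: "X \<in> Ob A" "Y \<in> Ob A" and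
    x: "Arr (fob (P (- w)) X) Y i (Poly_Mapping.lookup f (- w)) \<in> arrows A"
    using f by (simp_all add: Arr_in_arrows P_ob)
  show "Poly_Mapping.lookup (bd orbit.total (Arr X Y i (phi X Y i f))) w
      = Poly_Mapping.lookup (phi X Y (i + 1) (bd skew.total (Arr X Y i f))) w"
    using ob P_bd[OF x, of w]
    by (simp add: lookup_phi orbit.lookup_bd_total[OF phi_arrows[OF f]] skew.lookup_bd_total[OF f]
        comp_at_Arr comp_at_Arr fmap_Arr)
qed

text \<open>Composition does mix weights, so the comparison is made for single weights and extended
  by additivity in both factors.\<close>

lemma phi_cmp:
  assumes g: "Arr Y Z j g \<in> arrows skew.total" and f: "Arr X Y i f \<in> arrows skew.total"
  shows "cmp orbit.total (Arr Y Z j (phi Y Z j g)) (Arr X Y i (phi X Y i f))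
    = phi X Z (j + i) (cmp skew.total (Arr Y Z j g) (Arr X Y i f))"
  using g
proof (induction rule: skew.total_hom_induct)
  case (add g g')
  then show ?case using f
    by (simp add: skew.cmp_total_add_left orbit.cmp_total_add_left phi_add phi_arrows skew.Arr_cmp_total_in_arrows)
next
  case g: (single v y)
  have g': "Arr Y Z j (Poly_Mapping.single v y) \<in> arrows skew.total"
    using g skew.arrows_obs[OF assms(1)] by simp
  from f show ?case
  proof (induction rule: skew.total_hom_induct)
    case (add f f')
    then show ?case using g'
      by (simp add: skew.cmp_total_add_right orbit.cmp_total_add_right phi_add phi_arrows
          skew.Arr_cmp_total_in_arrows del: skew.single_in_arrows)
  next
    case f: (single w x)
    have ob: "X \<in> Ob A" "Y \<in> Ob A" "Z \<in> Ob A"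
      using skew.arrows_obs assms by blast+
    let ?y = "Arr (fob (P v) Y) Z j y" and ?x = "Arr (fob (P w) X) Y i x"
    have y: "?y \<in> arrows A" and x: "?x \<in> arrows A"
      using f g ob by (simp_all add: Arr_in_arrows P_ob)
    have Px: "fmap (P v) ?x \<in> arrows A" by (rule P_arrows[OF x])
    \<comment> \<open>Applying F^-(v+w) to the skew composite y F^v(x) turns the right factor into
      F^-w x and the left one into F^-w F^-v y, the shape of an orbit composite.\<close>
    have "fmap (P (- (v + w))) (cmp_arr A ?y (fmap (P v) ?x))
        = cmp_arr A (fmap (P (- (v + w))) ?y) (fmap (P (- (v + w))) (fmap (P v) ?x))"
      by (rule P_cmp[OF y Px]) simp
    also have "fmap (P (- (v + w))) (fmap (P v) ?x) = fmap (P (- (v + w) + v)) ?x"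
      by (rule fmap_P_add[OF x, symmetric])
    also have "- (v + w) + v = - w" by simp
    also have "- (v + w) = - w + - v" by simp
    also have "fmap (P (- w + - v)) ?y = fmap (P (- w)) (fmap (P (- v)) ?y)"
      by (rule fmap_P_add[OF y])
    finally have "val (fmap (P (- w + - v)) (cmp_arr A ?y (fmap (P v) ?x)))
        = cmp A (fmap (P (- w)) (fmap (P (- v)) ?y)) (fmap (P (- w)) ?x)"
      by simp
    \<comment> \<open>Restated with w + v, the order in which \<open>total\<close> writes the weight
      of a composite.\<close>
    then have eq: "fmor (P (- (w + v))) (fob (P (w + v)) X) Z (j + i) (cmp A ?y (fmap (P v) ?x))
        = cmp A (fmap (P (- w)) (fmap (P (- v)) ?y)) (fmap (P (- w)) ?x)"
      using ob by (simp add: fob_P_add[of X v w, unfolded add.commute[of v w]])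
    have hx: "fmor (P (- w)) (fob (P w) X) Y i x \<in> Hom A X (fob (P (- w)) Y) i"
      using P_arrows[OF x, of "- w"] ob by (simp add: arrows_def)
    have hy: "fmor (P (- v)) (fob (P v) Y) Z j y \<in> Hom A Y (fob (P (- v)) Z) j"
      using P_arrows[OF y, of "- v"] ob by (simp add: arrows_def)
    have "cmp orbit.total (Arr Y Z j (phi Y Z j (Poly_Mapping.single v y)))
        (Arr X Y i (phi X Y i (Poly_Mapping.single w x)))
      = Poly_Mapping.single (- w + - v) (cmp A (fmap (P (- w)) (fmap (P (- v)) ?y)) (fmap (P (- w)) ?x))"
      using ob hx hy by (simp add: phi_single orbit.cmp_total_single fmap_Arr)
    also have "\<dots> = phi X Z (j + i) (cmp skew.total (Arr Y Z j (Poly_Mapping.single v y))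
        (Arr X Y i (Poly_Mapping.single w x)))"
      using ob f g eq by (simp add: phi_single skew.cmp_total_single)
    finally show ?case .
  qed
qed

section \<open>The comparison functor\<close>

definition Phi :: "('o, int \<Rightarrow>\<^sub>0 'm, 'o, int \<Rightarrow>\<^sub>0 'm) gfun" where
  "Phi = frestrict skew.total \<lparr>fob = (\<lambda>X. X), fmor = phi\<rparr>"

lemma fmap_Phi:
  assumes "f \<in> arrows skew.total"
  shows "fmap Phi f = Arr (src f) (tgt f) (deg f) (phi (src f) (tgt f) (deg f) (val f))"
  using assms by (simp add: Phi_def fmap_frestrict) (simp add: fmap_def)

lemma gfunctor_Phi: "gfunctor skew.total orbit.total Phi"
  unfolding Phi_def
proof (rule gfunctorI)
  fix f assume "f \<in> arrows skew.total"
  then show "fmap \<lparr>fob = \<lambda>X. X, fmor = phi\<rparr> f \<in> arrows orbit.total"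
    by (cases f) (simp add: fmap_Arr phi_arrows)
next
  fix X assume "X \<in> Ob skew.total"
  \<comment> \<open>Units live in weight 0, where F^0 is the identity and -0 = 0, so
    \<open>phi\<close> fixes them.\<close>
  moreover from this have "fmor (P 0) X X 0 (ident A X) = ident A X"
    using P_ident[of X 0] by (simp add: ident_arr_def fmap_Arr)
  ultimately show "fmap \<lparr>fob = \<lambda>X. X, fmor = phi\<rparr> (ident_arr skew.total X)
      = ident_arr orbit.total (fob \<lparr>fob = \<lambda>X. X, fmor = phi\<rparr> X)"
    by (simp add: fmap_Arr ident_arr_def phi_single)
qed (use skew.graded_cat_total phi_add phi_scale in simp_all)

lemma dg_functor_Phi: "dg_functor skew.total orbit.total Phi"
  unfolding dg_functor_def
proof (intro conjI ballI impI gfunctor_Phi)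
  fix f assume f: "f \<in> arrows skew.total"
  then show "bd_arr orbit.total (fmap Phi f) = fmap Phi (bd_arr skew.total f)"
    using skew.bd_total_in_arrows[OF f] phi_bd
    by (cases f) (simp add: fmap_Phi, simp add: bd_arr_def)
  fix g assume g: "g \<in> arrows skew.total" and fg: "src f = tgt g"
  with f show "cmp_arr orbit.total (fmap Phi f) (fmap Phi g) = fmap Phi (cmp_arr skew.total f g)"
    using skew.cmp_total_in_arrows[OF g f] phi_cmp
    by (cases f; cases g) (simp add: fmap_Phi, simp add: cmp_arr_def)
qed

lemma bijective_functor_Phi: "bijective_functor skew.total orbit.total Phi"
  unfolding bijective_functor_def
proof (intro conjI ballI allI)
  show "bij_betw (fob Phi) (Ob skew.total) (Ob orbit.total)"
    using bij_betw_cong[of "Ob A" "fob Phi" "\<lambda>X. X" "Ob A"]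
    by (simp add: Phi_def fob_frestrict bij_betw_def)
  fix X Y i assume ob: "X \<in> Ob skew.total" "Y \<in> Ob skew.total"
  \<comment> \<open>\<open>Phi\<close> is restricted and agrees with \<open>phi\<close> only on
    morphism spaces, so bijectivity is transferred by congruence.\<close>
  have "fmor Phi X Y i f = phi X Y i f" if "f \<in> Hom skew.total X Y i" for f
    using that ob by (simp add: Phi_def frestrict_def Arr_in_arrows)
  then show "bij_betw (fmor Phi X Y i) (Hom skew.total X Y i) (Hom orbit.total (fob Phi X) (fob Phi Y) i)"
    using ob bij_betw_phi[of X Y i] bij_betw_cong[of "Hom skew.total X Y i" "fmor Phi X Y i" "phi X Y i"]
    by (simp add: Phi_def fob_frestrict)
qed

lemma dg_iso_Phi: "dg_iso skew.total orbit.total Phi"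
  by (simp add: dg_iso_def skew.dg_category_total orbit.dg_category_total dg_functor_Phi
      bijective_functor_Phi)

end

text \<open>The translation changes neither objects nor morphism spaces, so bijectivity carries over
  literally and only the structure maps need the comparison of functors.\<close>

lemma ainf_iso_ainf_of_dg:
  assumes "dg_iso C D F"
  shows "ainf_iso (ainf_of_dg C) (ainf_of_dg D) F"
  using assms
  by (simp add: ainf_iso_def dg_iso_def ainf_category_ainf_of_dg ainf_functor_ainf_of_dg_iff)

theorem mainTheorem1:
  fixes A :: "('o, 'k::field, 'm::ab_group_add) dgcat"
    and F :: "('o, 'm, 'o, 'm) gfun"
  assumes "dg_category A"
    and "F \<in> carrier (dg_Aut A)"
  shows "strict_action integer_group (ainf_of_dg A) (int_action (ainf_of_dg A) F)
    \<and> (\<exists>\<Phi>. ainf_iso (skew (ainf_of_dg A) integer_group (int_action (ainf_of_dg A) F))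
                    (ainf_of_dg (dg_orbit A F)) \<Phi>
         \<and> higher_mu_vanish (skew (ainf_of_dg A) integer_group (int_action (ainf_of_dg A) F))
         \<and> dg_iso (dg_of_ainf (skew (ainf_of_dg A) integer_group (int_action (ainf_of_dg A) F)))
                  (dg_orbit A F) \<Phi>)"
proof -
  let ?G = "dg_Aut A"
  interpret G: group ?G by (rule group_dg_Aut[OF assms(1)])
  define P where "P = (\<lambda>l::int. F [^]\<^bsub>?G\<^esub> l)"
  have act: "int_action (ainf_of_dg A) F = P"
    by (simp add: int_action_def ainf_Aut_ainf_of_dg[OF assms(1)] P_def)
  have "P l \<in> carrier ?G" for l by (simp add: P_def assms(2))
  then interpret dg_int_action A P
  proof (unfold_locales)
    show "P 0 = fun_id A" by (simp add: P_def) (simp add: dg_Aut_def invertibles_def)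
    show "P (l + m) = fun_comp A (P l) (P m)" for l m
      using G.int_pow_mult[OF assms(2), of l m] by (simp add: P_def) (simp add: dg_Aut_def invertibles_def)
  qed (use assms in \<open>auto simp: dg_Aut_def invertibles_def\<close>)
  have "P \<in> hom integer_group ?G"
    unfolding P_def by (rule G.hom_integer_group_pow[OF assms(2)])
  then have "strict_action integer_group (ainf_of_dg A) P"
    by (simp add: strict_action_def ainf_category_ainf_of_dg[OF assms(1)] ainf_Aut_ainf_of_dg[OF assms(1)])
  moreover have "F [^]\<^bsub>?G\<^esub> l = P l" for l :: int
    by (simp add: P_def)
  \<comment> \<open>Once the powers are named \<open>P\<close>, the orbit category unfolds to the
    totalisation term by term.\<close>
  then have "dg_orbit A F = orbit.total"
    by (simp add: dg_orbit_def orbit.total_def at_comp_at orbit_component_def)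
  \<comment> \<open>The skew category is now \<open>ainf_of_dg\<close> of \<open>skew.total\<close>,
    and \<open>dg_of_ainf\<close> undoes this. Hence \<open>Phi\<close> witnesses both
    isomorphisms.\<close>
  ultimately show ?thesis
    unfolding act skew_eq
    using dg_iso_Phi ainf_iso_ainf_of_dg[OF dg_iso_Phi]
    by (auto simp: dg_of_ainf_ainf_of_dg higher_mu_vanish_ainf_of_dg)
qed

end
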